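(* Let $G=\mathbb{Z}/2\times\mathbb{Z}/2=\{1,t_1,t_2,t_1t_2\}$ and let $A=\mathbb{C}[\mathbb{Z}/2]$ be the complex group algebra (with its standard Hopf algebra structure) of $\mathbb{Z}/2=\{1,t\}$. Equip $A$ with the weak $G$-action given by $\varphi_g=\mathrm{id}_A$ for all $g\in G$ and by the compositors $$c_{t_1,t_1}=c_{t_2,t_1}=c_{t_1,t_1t_2}=c_{t_2,t_1t_2}=t,\qquad c_{g,h}=1\ \text{ for all other pairs } (g,h)\in G\times G .$$ Then there is no strictification of $A$ as a Hopf algebra; that is, there is no Hopf algebra $B$ over $\mathbb{C}$ with a strict $G$-action together with an equivalence $A\text{-}\mathrm{mod}\xrightarrow{\sim}B\text{-}\mathrm{mod}$ of tensor categories with $G$-action.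
   Context: Weak action. Let $G$ be a finite group and $A$ an associative unital algebra over a field $\mathbb{K}$. A weak $G$-action on $A$ consists of unital algebra automorphisms $\varphi_g$ of $A$ ($g\in G$) and invertible elements $c_{g,h}\in A^\times$ ($g,h\in G$), called compositors, such that for all $g,h,k\in G$: $\varphi_g\circ\varphi_h=\mathrm{Inn}_{c_{g,h}}\circ\varphi_{gh}$, $\ \varphi_g(c_{h,k})\,c_{g,hk}=c_{g,h}\,c_{gh,k}$, and $c_{1,1}=1$, where $\mathrm{Inn}_x(a)=xax^{-1}$. The action is strict if $c_{g,h}=1$ for all $g,h$. A weak $G$-action on a Hopf algebra $A$ is a weak $G$-action on the underlying algebra such that each $\varphi_g$ is a Hopf algebra automorphism and each $c_{g,h}$ is group-like, $\Delta(c_{g,h})=c_{g,h}\otimes c_{g,h}$. Induced categorical action. $A\text{-}\mathrm{mod}$ denotes the category of right $A$-modules, with its tensor product coming from the coproduct. A weak $G$-action on a Hopf algebra $A$ induces an action of $G$ on $A\text{-}\mathrm{mod}$: for $g\in G$ and a right module $M$, ${}^gM$ is the vector space $M$ with $a\in A$ acting by $m\mapsto m.\varphi_{g^{-1}}(a)$; on morphisms ${}^gf=f$. The natural isomorphisms (compositors) $\alpha_{g,h}(M):{}^g({}^hM)\to{}^{gh}M$ are $m\mapsto m.c_{h^{-1},g^{-1}}$. Equivalence of tensor categories with $G$-action $A\text{-}\mathrm{mod}\to B\text{-}\mathrm{mod}$: a ($\mathbb{K}$-linear, strong monoidal) tensor functor $F$ that is an equivalence of categories, together with natural isomorphisms $\psi_g(M):F({}^gM)\to{}^gF(M)$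 ($g\in G$) such that for all $g,h\in G$ and all $M$, as morphisms $F({}^g({}^hM))\to{}^{gh}F(M)$, $$\psi_{gh}(M)\circ F(\alpha^A_{g,h}(M))=\alpha^B_{g,h}(F(M))\circ{}^g\psi_h(M)\circ\psi_g({}^hM),$$ where $\alpha^A,\alpha^B$ are the compositors on the two categories. *)

theory Defs
  imports Complex_Main "HOL-Algebra.Module" "HOL-Algebra.Elementary_Groups"
begin

text \<open>
  Vector spaces and algebras over a field \<^typ>\<open>'k\<close> are records of type \<^typ>\<open>('k, 'a) module\<close>. For plain
  vector spaces and modules over an algebra, the components \<^const>\<open>monoid.mult\<close> and \<^const>\<open>monoid.one\<close>
  that such a record inherits from \<^typ>\<open>'a ring\<close> carry no information.
\<close>

definition field_algebra :: "('k::field, 'k) module" where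
  "field_algebra = \<lparr>carrier = UNIV, mult = (*), one = 1, zero = 0, add = (+), smult = (*)\<rparr>"


abbreviation vector_space_on :: "('k::field, 'a, 'm) module_scheme \<Rightarrow> bool" where
  "vector_space_on V \<equiv> module (field_algebra :: ('k, 'k) module) V"

definition linear_on ::
  "('k, 'a, 'm) module_scheme \<Rightarrow> ('k, 'b, 'n) module_scheme \<Rightarrow> ('a \<Rightarrow> 'b) \<Rightarrow> bool" where
  "linear_on V W f \<longleftrightarrow> f \<in> carrier V \<rightarrow> carrier W \<and>
     (\<forall>x\<in>carrier V. \<forall>y\<in>carrier V. f (x \<oplus>\<^bsub>V\<^esub> y) = f x \<oplus>\<^bsub>W\<^esub> f y) \<and>
     (\<forall>s. \<forall>x\<in>carrier V. f (s \<odot>\<^bsub>V\<^esub> x) = s \<odot>\<^bsub>W\<^esub> f x)"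

text \<open>Unlike \<^locale>\<open>algebra\<close>, this does not require the multiplication to be commutative.\<close>

definition assoc_algebra :: "('k::field, 'a, 'm) module_scheme \<Rightarrow> bool" where
  "assoc_algebra A \<longleftrightarrow> ring A \<and> vector_space_on A \<and>
     (\<forall>s. \<forall>x\<in>carrier A. \<forall>y\<in>carrier A.
        (s \<odot>\<^bsub>A\<^esub> x) \<otimes>\<^bsub>A\<^esub> y = s \<odot>\<^bsub>A\<^esub> (x \<otimes>\<^bsub>A\<^esub> y) \<and> x \<otimes>\<^bsub>A\<^esub> (s \<odot>\<^bsub>A\<^esub> y) = s \<odot>\<^bsub>A\<^esub> (x \<otimes>\<^bsub>A\<^esub> y))"

definition algebra_hom ::
  "('k, 'a, 'm) module_scheme \<Rightarrow> ('k, 'b, 'n) module_scheme \<Rightarrow> ('a \<Rightarrow> 'b) \<Rightarrow> bool" where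
  "algebra_hom A B f \<longleftrightarrow> f \<in> ring_hom A B \<and> linear_on A B f"


section \<open>Tensor products of vector spaces\<close>

text \<open>
  The list \<open>[(x\<^sub>1, y\<^sub>1), \<dots>, (x\<^sub>n, y\<^sub>n)]\<close> stands for the formal sum \<open>x\<^sub>1 \<otimes> y\<^sub>1 + \<dots> + x\<^sub>n \<otimes> y\<^sub>n\<close>. The tensor
  product is the quotient of the formal sums by the congruence that bilinearity generates. Scalars
  are absorbed into the entries.
\<close>

inductive tensor_eq ::
  "('k, 'a, 'm) module_scheme \<Rightarrow> ('k, 'b, 'n) module_scheme \<Rightarrow> ('a \<times> 'b) list \<Rightarrow> ('a \<times> 'b) list \<Rightarrow> bool"
  for V W where
  refl: "set xs \<subseteq> carrier V \<times> carrier W \<Longrightarrow> tensor_eq V W xs xs"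
| sym: "tensor_eq V W xs ys \<Longrightarrow> tensor_eq V W ys xs"
| trans: "tensor_eq V W xs ys \<Longrightarrow> tensor_eq V W ys zs \<Longrightarrow> tensor_eq V W xs zs"
| append: "tensor_eq V W xs xs' \<Longrightarrow> tensor_eq V W ys ys' \<Longrightarrow> tensor_eq V W (xs @ ys) (xs' @ ys')"
| comm: "set xs \<subseteq> carrier V \<times> carrier W \<Longrightarrow> set ys \<subseteq> carrier V \<times> carrier W \<Longrightarrow>
    tensor_eq V W (xs @ ys) (ys @ xs)"
| add_left: "x \<in> carrier V \<Longrightarrow> x' \<in> carrier V \<Longrightarrow> y \<in> carrier W \<Longrightarrow>
    tensor_eq V W [(x \<oplus>\<^bsub>V\<^esub> x', y)] [(x, y), (x', y)]"
| add_right: "x \<in> carrier V \<Longrightarrow> y \<in> carrier W \<Longrightarrow> y' \<in> carrier W \<Longrightarrow>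
    tensor_eq V W [(x, y \<oplus>\<^bsub>W\<^esub> y')] [(x, y), (x, y')]"
| smult: "x \<in> carrier V \<Longrightarrow> y \<in> carrier W \<Longrightarrow>
    tensor_eq V W [(s \<odot>\<^bsub>V\<^esub> x, y)] [(x, s \<odot>\<^bsub>W\<^esub> y)]"
| zero: "y \<in> carrier W \<Longrightarrow> tensor_eq V W [(\<zero>\<^bsub>V\<^esub>, y)] []"

text \<open>
  An element of the quotient is represented by a chosen member of its class: \<open>tsum V W xs\<close> is the
  element of \<open>V \<otimes> W\<close> denoted by the formal sum \<open>xs\<close>, and it is itself a formal sum in the class of \<open>xs\<close>.
\<close>

definition tsum ::
  "('k, 'a, 'm) module_scheme \<Rightarrow> ('k, 'b, 'n) module_scheme \<Rightarrow> ('a \<times> 'b) list \<Rightarrow> ('a \<times> 'b) list" where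
  "tsum V W xs = (SOME ys. tensor_eq V W xs ys)"

text \<open>The multiplication and unit below are meaningful if both factors are algebras.\<close>

definition tensor ::
  "('k, 'a, 'm) module_scheme \<Rightarrow> ('k, 'b, 'n) module_scheme \<Rightarrow> ('k, ('a \<times> 'b) list) module" where
  "tensor V W =
     \<lparr>carrier = tsum V W ` {xs. set xs \<subseteq> carrier V \<times> carrier W},
      mult = (\<lambda>u v. tsum V W [(x \<otimes>\<^bsub>V\<^esub> x', y \<otimes>\<^bsub>W\<^esub> y'). (x, y) \<leftarrow> u, (x', y') \<leftarrow> v]),
      one = tsum V W [(\<one>\<^bsub>V\<^esub>, \<one>\<^bsub>W\<^esub>)],
      zero = tsum V W [],
      add = (\<lambda>u v. tsum V W (u @ v)),
      smult = (\<lambda>s u. tsum V W [(s \<odot>\<^bsub>V\<^esub> x, y). (x, y) \<leftarrow> u])\<rparr>"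

text \<open>The linear map on \<open>V \<otimes> W\<close> that a bilinear map \<open>f\<close> on \<open>V \<times> W\<close> with values in \<open>Z\<close> induces.\<close>

definition tensor_lift :: "('k, 'c, 'm) module_scheme \<Rightarrow> ('a \<Rightarrow> 'b \<Rightarrow> 'c) \<Rightarrow> ('a \<times> 'b) list \<Rightarrow> 'c" where
  "tensor_lift Z f u = foldr (\<lambda>(x, y) z. f x y \<oplus>\<^bsub>Z\<^esub> z) u \<zero>\<^bsub>Z\<^esub>"


section \<open>Hopf algebras\<close>

record ('k, 'a) hopf = "('k, 'a) module" +
  comult :: "'a \<Rightarrow> ('a \<times> 'a) list"
  counit :: "'a \<Rightarrow> 'k"
  antipode :: "'a \<Rightarrow> 'a"

text \<open>In coassociativity, both sides are taken in \<open>H \<otimes> (H \<otimes> H)\<close>.\<close>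

definition hopf_algebra :: "('k::field, 'a) hopf \<Rightarrow> bool" where
  "hopf_algebra H \<longleftrightarrow>
     assoc_algebra H \<and>
     algebra_hom H (tensor H H) (comult H) \<and>
     algebra_hom H field_algebra (counit H) \<and>
     (\<forall>a\<in>carrier H.
        tsum H (tensor H H) [(x, tsum H H [(y, z)]). (v, z) \<leftarrow> comult H a, (x, y) \<leftarrow> comult H v] =
        tsum H (tensor H H) [(x, comult H v). (x, v) \<leftarrow> comult H a]) \<and>
     (\<forall>a\<in>carrier H. tensor_lift H (\<lambda>x y. counit H x \<odot>\<^bsub>H\<^esub> y) (comult H a) = a) \<and>
     (\<forall>a\<in>carrier H. tensor_lift H (\<lambda>x y. counit H y \<odot>\<^bsub>H\<^esub> x) (comult H a) = a) \<and>
     linear_on H H (antipode H) \<and>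
     (\<forall>a\<in>carrier H. tensor_lift H (\<lambda>x y. antipode H x \<otimes>\<^bsub>H\<^esub> y) (comult H a) = counit H a \<odot>\<^bsub>H\<^esub> \<one>\<^bsub>H\<^esub>) \<and>
     (\<forall>a\<in>carrier H. tensor_lift H (\<lambda>x y. x \<otimes>\<^bsub>H\<^esub> antipode H y) (comult H a) = counit H a \<odot>\<^bsub>H\<^esub> \<one>\<^bsub>H\<^esub>)"

definition hopf_automorphism :: "('k::field, 'a) hopf \<Rightarrow> ('a \<Rightarrow> 'a) \<Rightarrow> bool" where
  "hopf_automorphism H f \<longleftrightarrow>
     algebra_hom H H f \<and> bij_betw f (carrier H) (carrier H) \<and>
     (\<forall>a\<in>carrier H. comult H (f a) = tsum H H [(f x, f y). (x, y) \<leftarrow> comult H a]) \<and>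
     (\<forall>a\<in>carrier H. counit H (f a) = counit H a) \<and>
     (\<forall>a\<in>carrier H. antipode H (f a) = f (antipode H a))"

definition group_algebra :: "('g, 'r) monoid_scheme \<Rightarrow> ('k::field, 'g \<Rightarrow> 'k) module" where
  "group_algebra G =
     \<lparr>carrier = {f. finite {x. f x \<noteq> 0} \<and> {x. f x \<noteq> 0} \<subseteq> carrier G},
      mult = (\<lambda>f h x. \<Sum>(y, z) | f y \<noteq> 0 \<and> h z \<noteq> 0 \<and> y \<otimes>\<^bsub>G\<^esub> z = x. f y * h z),
      one = (\<lambda>x. if x = \<one>\<^bsub>G\<^esub> then 1 else 0),
      zero = (\<lambda>x. 0),
      add = (\<lambda>f h x. f x + h x),
      smult = (\<lambda>s f x. s * f x)\<rparr>"

definition group_elem :: "'g \<Rightarrow> 'g \<Rightarrow> 'k::field" where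
  "group_elem g = (\<lambda>x. if x = g then 1 else 0)"

definition group_hopf_algebra :: "('g, 'r) monoid_scheme \<Rightarrow> ('k::field, 'g \<Rightarrow> 'k) hopf" where
  "group_hopf_algebra G =
     module.extend (group_algebra G)
       \<lparr>comult = (\<lambda>f. \<Oplus>\<^bsub>tensor (group_algebra G) (group_algebra G)\<^esub> x \<in> {x. f x \<noteq> 0}.
          f x \<odot>\<^bsub>tensor (group_algebra G) (group_algebra G)\<^esub>
            tsum (group_algebra G) (group_algebra G) [(group_elem x, group_elem x)]),
        counit = (\<lambda>f. \<Sum>x | f x \<noteq> 0. f x),
        antipode = (\<lambda>f x. if x \<in> carrier G then f (inv\<^bsub>G\<^esub> x) else 0)\<rparr>"


section \<open>Weak actions\<close>

definition weak_action ::
  "('g, 'r) monoid_scheme \<Rightarrow> ('k::field, 'a, 'm) module_scheme \<Rightarrow>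
    ('g \<Rightarrow> 'a \<Rightarrow> 'a) \<Rightarrow> ('g \<Rightarrow> 'g \<Rightarrow> 'a) \<Rightarrow> bool" where
  "weak_action G A \<phi> c \<longleftrightarrow>
     group G \<and> finite (carrier G) \<and> assoc_algebra A \<and>
     (\<forall>g\<in>carrier G. algebra_hom A A (\<phi> g) \<and> bij_betw (\<phi> g) (carrier A) (carrier A)) \<and>
     (\<forall>g\<in>carrier G. \<forall>h\<in>carrier G. c g h \<in> Units A) \<and>
     (\<forall>g\<in>carrier G. \<forall>h\<in>carrier G. \<forall>a\<in>carrier A.
        \<phi> g (\<phi> h a) = c g h \<otimes>\<^bsub>A\<^esub> \<phi> (g \<otimes>\<^bsub>G\<^esub> h) a \<otimes>\<^bsub>A\<^esub> inv\<^bsub>A\<^esub> (c g h)) \<and>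
     (\<forall>g\<in>carrier G. \<forall>h\<in>carrier G. \<forall>k\<in>carrier G.
        \<phi> g (c h k) \<otimes>\<^bsub>A\<^esub> c g (h \<otimes>\<^bsub>G\<^esub> k) = c g h \<otimes>\<^bsub>A\<^esub> c (g \<otimes>\<^bsub>G\<^esub> h) k) \<and>
     c \<one>\<^bsub>G\<^esub> \<one>\<^bsub>G\<^esub> = \<one>\<^bsub>A\<^esub>"

definition weak_hopf_action ::
  "('g, 'r) monoid_scheme \<Rightarrow> ('k::field, 'a) hopf \<Rightarrow>
    ('g \<Rightarrow> 'a \<Rightarrow> 'a) \<Rightarrow> ('g \<Rightarrow> 'g \<Rightarrow> 'a) \<Rightarrow> bool" where
  "weak_hopf_action G H \<phi> c \<longleftrightarrow>
     hopf_algebra H \<and> weak_action G H \<phi> c \<and>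
     (\<forall>g\<in>carrier G. hopf_automorphism H (\<phi> g)) \<and>
     (\<forall>g\<in>carrier G. \<forall>h\<in>carrier G. comult H (c g h) = tsum H H [(c g h, c g h)])"

definition strict_compositors ::
  "('g, 'r) monoid_scheme \<Rightarrow> ('k, 'a, 'm) module_scheme \<Rightarrow> ('g \<Rightarrow> 'g \<Rightarrow> 'a) \<Rightarrow> bool" where
  "strict_compositors G A c \<longleftrightarrow> (\<forall>g\<in>carrier G. \<forall>h\<in>carrier G. c g h = \<one>\<^bsub>A\<^esub>)"


section \<open>Tensor categories with group action\<close>

text \<open>\<open>Comp C f e\<close> is \<open>f\<close> after \<open>e\<close>.\<close>

record ('o, 'm) category =
  Ob :: "'o set"
  Hom :: "'o \<Rightarrow> 'o \<Rightarrow> 'm set"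
  Id :: "'o \<Rightarrow> 'm"
  Comp :: "'m \<Rightarrow> 'm \<Rightarrow> 'm"

record ('k, 'o, 'm) tensor_category = "('o, 'm) category" +
  HomAdd :: "'m \<Rightarrow> 'm \<Rightarrow> 'm"
  HomScale :: "'k \<Rightarrow> 'm \<Rightarrow> 'm"
  TOb :: "'o \<Rightarrow> 'o \<Rightarrow> 'o"
  TMor :: "'m \<Rightarrow> 'm \<Rightarrow> 'm"
  Unit :: "'o"
  Assoc :: "'o \<Rightarrow> 'o \<Rightarrow> 'o \<Rightarrow> 'm"
  LUnit :: "'o \<Rightarrow> 'm"
  RUnit :: "'o \<Rightarrow> 'm"

record ('g, 'k, 'o, 'm) tensor_category_with_action = "('k, 'o, 'm) tensor_category" +
  ActOb :: "'g \<Rightarrow> 'o \<Rightarrow> 'o"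
  ActMor :: "'g \<Rightarrow> 'm \<Rightarrow> 'm"
  Compositor :: "'g \<Rightarrow> 'g \<Rightarrow> 'o \<Rightarrow> 'm"

definition is_functor ::
  "('o, 'm, 'z) category_scheme \<Rightarrow> ('p, 'n, 'y) category_scheme \<Rightarrow> ('o \<Rightarrow> 'p) \<Rightarrow> ('m \<Rightarrow> 'n) \<Rightarrow> bool" where
  "is_functor C D F F' \<longleftrightarrow>
     (\<forall>X\<in>Ob C. F X \<in> Ob D) \<and>
     (\<forall>X\<in>Ob C. \<forall>Y\<in>Ob C. \<forall>f\<in>Hom C X Y. F' f \<in> Hom D (F X) (F Y)) \<and>
     (\<forall>X\<in>Ob C. F' (Id C X) = Id D (F X)) \<and>
     (\<forall>X\<in>Ob C. \<forall>Y\<in>Ob C. \<forall>Z\<in>Ob C. \<forall>e\<in>Hom C X Y. \<forall>f\<in>Hom C Y Z.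
        F' (Comp C f e) = Comp D (F' f) (F' e))"

definition is_iso :: "('o, 'm, 'z) category_scheme \<Rightarrow> 'o \<Rightarrow> 'o \<Rightarrow> 'm \<Rightarrow> bool" where
  "is_iso C X Y f \<longleftrightarrow> f \<in> Hom C X Y \<and> (\<exists>e\<in>Hom C Y X. Comp C e f = Id C X \<and> Comp C f e = Id C Y)"

definition natural_iso ::
  "('o, 'm, 'z) category_scheme \<Rightarrow> ('p, 'n, 'y) category_scheme \<Rightarrow>
    ('o \<Rightarrow> 'p) \<Rightarrow> ('m \<Rightarrow> 'n) \<Rightarrow> ('o \<Rightarrow> 'p) \<Rightarrow> ('m \<Rightarrow> 'n) \<Rightarrow> ('o \<Rightarrow> 'n) \<Rightarrow> bool" where
  "natural_iso C D F F' E E' \<eta> \<longleftrightarrow>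
     (\<forall>X\<in>Ob C. is_iso D (F X) (E X) (\<eta> X)) \<and>
     (\<forall>X\<in>Ob C. \<forall>Y\<in>Ob C. \<forall>f\<in>Hom C X Y. Comp D (\<eta> Y) (F' f) = Comp D (E' f) (\<eta> X))"

definition equivalence_functor ::
  "('o, 'm, 'z) category_scheme \<Rightarrow> ('p, 'n, 'y) category_scheme \<Rightarrow> ('o \<Rightarrow> 'p) \<Rightarrow> ('m \<Rightarrow> 'n) \<Rightarrow> bool" where
  "equivalence_functor C D F F' \<longleftrightarrow>
     is_functor C D F F' \<and>
     (\<exists>E E' \<eta> \<epsilon>. is_functor D C E E' \<and>
        natural_iso C C (\<lambda>X. X) (\<lambda>f. f) (E \<circ> F) (E' \<circ> F') \<eta> \<and>
        natural_iso D D (F \<circ> E) (F' \<circ> E') (\<lambda>X. X) (\<lambda>f. f) \<epsilon>)"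

definition linear_functor ::
  "('k, 'o, 'm, 'z) tensor_category_scheme \<Rightarrow> ('k, 'p, 'n, 'y) tensor_category_scheme \<Rightarrow>
    ('o \<Rightarrow> 'p) \<Rightarrow> ('m \<Rightarrow> 'n) \<Rightarrow> bool" where
  "linear_functor C D F F' \<longleftrightarrow>
     is_functor C D F F' \<and>
     (\<forall>X\<in>Ob C. \<forall>Y\<in>Ob C. \<forall>e\<in>Hom C X Y. \<forall>f\<in>Hom C X Y.
        F' (HomAdd C e f) = HomAdd D (F' e) (F' f)) \<and>
     (\<forall>X\<in>Ob C. \<forall>Y\<in>Ob C. \<forall>s. \<forall>f\<in>Hom C X Y. F' (HomScale C s f) = HomScale D s (F' f))"

definition strong_monoidal_functor ::
  "('k, 'o, 'm, 'z) tensor_category_scheme \<Rightarrow> ('k, 'p, 'n, 'y) tensor_category_scheme \<Rightarrow>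
    ('o \<Rightarrow> 'p) \<Rightarrow> ('m \<Rightarrow> 'n) \<Rightarrow> ('o \<Rightarrow> 'o \<Rightarrow> 'n) \<Rightarrow> 'n \<Rightarrow> bool" where
  "strong_monoidal_functor C D F F' J J\<^sub>0 \<longleftrightarrow>
     is_functor C D F F' \<and>
     (\<forall>X\<in>Ob C. \<forall>Y\<in>Ob C. is_iso D (TOb D (F X) (F Y)) (F (TOb C X Y)) (J X Y)) \<and>
     (\<forall>X\<in>Ob C. \<forall>X'\<in>Ob C. \<forall>Y\<in>Ob C. \<forall>Y'\<in>Ob C. \<forall>e\<in>Hom C X X'. \<forall>f\<in>Hom C Y Y'.
        Comp D (J X' Y') (TMor D (F' e) (F' f)) = Comp D (F' (TMor C e f)) (J X Y)) \<and>
     is_iso D (Unit D) (F (Unit C)) J\<^sub>0 \<and>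
     (\<forall>X\<in>Ob C. \<forall>Y\<in>Ob C. \<forall>Z\<in>Ob C.
        Comp D (F' (Assoc C X Y Z)) (Comp D (J (TOb C X Y) Z) (TMor D (J X Y) (Id D (F Z)))) =
        Comp D (J X (TOb C Y Z)) (Comp D (TMor D (Id D (F X)) (J Y Z)) (Assoc D (F X) (F Y) (F Z)))) \<and>
     (\<forall>X\<in>Ob C. LUnit D (F X) =
        Comp D (F' (LUnit C X)) (Comp D (J (Unit C) X) (TMor D J\<^sub>0 (Id D (F X))))) \<and>
     (\<forall>X\<in>Ob C. RUnit D (F X) =
        Comp D (F' (RUnit C X)) (Comp D (J X (Unit C)) (TMor D (Id D (F X)) J\<^sub>0)))"

definition equivalent_with_action ::
  "('g, 'r) monoid_scheme \<Rightarrow> ('g, 'k, 'o, 'm, 'z) tensor_category_with_action_scheme \<Rightarrow>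
    ('g, 'k, 'p, 'n, 'y) tensor_category_with_action_scheme \<Rightarrow> bool" where
  "equivalent_with_action G C D \<longleftrightarrow>
     (\<exists>F F' J J\<^sub>0 \<psi>.
        equivalence_functor C D F F' \<and>
        linear_functor C D F F' \<and>
        strong_monoidal_functor C D F F' J J\<^sub>0 \<and>
        (\<forall>g\<in>carrier G. natural_iso C D
           (F \<circ> ActOb C g) (F' \<circ> ActMor C g) (ActOb D g \<circ> F) (ActMor D g \<circ> F') (\<psi> g)) \<and>
        (\<forall>g\<in>carrier G. \<forall>h\<in>carrier G. \<forall>X\<in>Ob C.
           Comp D (\<psi> (g \<otimes>\<^bsub>G\<^esub> h) X) (F' (Compositor C g h X)) =
           Comp D (Compositor D g h (F X)) (Comp D (ActMor D g (\<psi> h X)) (\<psi> g (ActOb C h X)))))"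


section \<open>The category of right modules over a Hopf algebra\<close>

text \<open>
  All modules of one category have their carriers inside one type, the universe. It contains the
  atoms of an arbitrary type \<^typ>\<open>'x\<close>, a copy of the field, which is the carrier of the tensor unit, and
  formal sums of pairs of its own elements, which make up the tensor product of two modules. Thus the
  modules of one universe are closed under tensor products, and the choice of \<^typ>\<open>'x\<close> governs its size.
\<close>

datatype ('k, 'x) universe =
    Atom 'x
  | Scalar (the_scalar: 'k)
  | Tensors (the_tensors: "(('k, 'x) universe \<times> ('k, 'x) universe) list")

record ('k, 'a, 'u) rmodule = "('k, 'u) module" +
  act :: "'u \<Rightarrow> 'a \<Rightarrow> 'u"

definition right_module :: "('k::field, 'a, 'm) module_scheme \<Rightarrow> ('k, 'a, 'u) rmodule \<Rightarrow> bool" where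
  "right_module A M \<longleftrightarrow>
     vector_space_on M \<and>
     (\<forall>a\<in>carrier A. linear_on M M (\<lambda>m. act M m a)) \<and>
     (\<forall>m\<in>carrier M. linear_on A M (act M m)) \<and>
     (\<forall>m\<in>carrier M. \<forall>a\<in>carrier A. \<forall>b\<in>carrier A. act M m (a \<otimes>\<^bsub>A\<^esub> b) = act M (act M m a) b) \<and>
     (\<forall>m\<in>carrier M. act M m \<one>\<^bsub>A\<^esub> = m)"

type_synonym ('k, 'a, 'x) umodule = "('k, 'a, ('k, 'x) universe) rmodule"

text \<open>
  A morphism is a triple of source, underlying map and target. The map is \<^const>\<open>undefined\<close> outside the
  carrier of the source.
\<close>

type_synonym ('k, 'a, 'x) umorphism =
  "('k, 'a, 'x) umodule \<times> (('k, 'x) universe \<Rightarrow> ('k, 'x) universe) \<times> ('k, 'a, 'x) umodule"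

definition mor ::
  "('k, 'a, 'x) umodule \<Rightarrow> (('k, 'x) universe \<Rightarrow> ('k, 'x) universe) \<Rightarrow> ('k, 'a, 'x) umodule \<Rightarrow>
    ('k, 'a, 'x) umorphism" where
  "mor M f N = (M, restrict f (carrier M), N)"

definition module_homs ::
  "('k, 'a, 'm) module_scheme \<Rightarrow> ('k, 'a, 'x) umodule \<Rightarrow> ('k, 'a, 'x) umodule \<Rightarrow>
    ('k, 'a, 'x) umorphism set" where
  "module_homs A M N = {mor M f N | f. linear_on M N f \<and>
     (\<forall>m\<in>carrier M. \<forall>a\<in>carrier A. f (act M m a) = act N (f m) a)}"

definition utsum ::
  "('k, 'a, 'x) umodule \<Rightarrow> ('k, 'a, 'x) umodule \<Rightarrow> (('k, 'x) universe \<times> ('k, 'x) universe) list \<Rightarrow>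
    ('k, 'x) universe" where
  "utsum M N xs = Tensors (tsum M N xs)"

text \<open>The vector space \<^term>\<open>tensor M N\<close>, moved into the universe, with \<open>(m \<otimes> n).a = m.a\<^sub>1 \<otimes> n.a\<^sub>2\<close>.\<close>

definition tensor_module ::
  "('k, 'a) hopf \<Rightarrow> ('k, 'a, 'x) umodule \<Rightarrow> ('k, 'a, 'x) umodule \<Rightarrow> ('k, 'a, 'x) umodule" where
  "tensor_module H M N =
     \<lparr>carrier = Tensors ` carrier (tensor M N),
      mult = undefined,
      one = undefined,
      zero = Tensors \<zero>\<^bsub>tensor M N\<^esub>,
      add = (\<lambda>u v. Tensors (the_tensors u \<oplus>\<^bsub>tensor M N\<^esub> the_tensors v)),
      smult = (\<lambda>s u. Tensors (s \<odot>\<^bsub>tensor M N\<^esub> the_tensors u)),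
      act = (\<lambda>u a. utsum M N [(act M m x, act N n y). (m, n) \<leftarrow> the_tensors u, (x, y) \<leftarrow> comult H a])\<rparr>"

definition unit_module :: "('k::field, 'a) hopf \<Rightarrow> ('k, 'a, 'x) umodule" where
  "unit_module H =
     \<lparr>carrier = range Scalar,
      mult = undefined,
      one = undefined,
      zero = Scalar 0,
      add = (\<lambda>u v. Scalar (the_scalar u + the_scalar v)),
      smult = (\<lambda>s u. Scalar (s * the_scalar u)),
      act = (\<lambda>u a. Scalar (the_scalar u * counit H a))\<rparr>"

definition twist :: "('a \<Rightarrow> 'a) \<Rightarrow> ('k, 'a, 'x) umodule \<Rightarrow> ('k, 'a, 'x) umodule" where
  "twist f M = M\<lparr>act := \<lambda>m a. act M m (f a)\<rparr>"

text \<open>The first argument fixes the type of atoms of the universe.\<close>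

definition mod_category ::
  "'x itself \<Rightarrow> ('g, 'r) monoid_scheme \<Rightarrow> ('k::field, 'a) hopf \<Rightarrow>
    ('g \<Rightarrow> 'a \<Rightarrow> 'a) \<Rightarrow> ('g \<Rightarrow> 'g \<Rightarrow> 'a) \<Rightarrow>
    ('g, 'k, ('k, 'a, 'x) umodule, ('k, 'a, 'x) umorphism) tensor_category_with_action" where
  "mod_category U G H \<phi> c =
     \<lparr>Ob = {M. right_module H M},
      Hom = module_homs H,
      Id = (\<lambda>M. mor M (\<lambda>m. m) M),
      Comp = (\<lambda>(_, f, P) (M, e, _). mor M (f \<circ> e) P),
      HomAdd = (\<lambda>(M, e, N) (_, f, _). mor M (\<lambda>m. e m \<oplus>\<^bsub>N\<^esub> f m) N),
      HomScale = (\<lambda>s (M, f, N). mor M (\<lambda>m. s \<odot>\<^bsub>N\<^esub> f m) N),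
      TOb = tensor_module H,
      TMor = (\<lambda>(M, e, M') (N, f, N'). mor (tensor_module H M N)
        (\<lambda>u. utsum M' N' [(e m, f n). (m, n) \<leftarrow> the_tensors u]) (tensor_module H M' N')),
      Unit = unit_module H,
      Assoc = (\<lambda>M N P. mor (tensor_module H (tensor_module H M N) P)
        (\<lambda>u. utsum M (tensor_module H N P)
          [(m, utsum N P [(n, p)]). (v, p) \<leftarrow> the_tensors u, (m, n) \<leftarrow> the_tensors v])
        (tensor_module H M (tensor_module H N P))),
      LUnit = (\<lambda>M. mor (tensor_module H (unit_module H) M)
        (\<lambda>u. tensor_lift M (\<lambda>s m. the_scalar s \<odot>\<^bsub>M\<^esub> m) (the_tensors u)) M),
      RUnit = (\<lambda>M. mor (tensor_module H M (unit_module H))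
        (\<lambda>u. tensor_lift M (\<lambda>m s. the_scalar s \<odot>\<^bsub>M\<^esub> m) (the_tensors u)) M),
      ActOb = (\<lambda>g. twist (\<phi> (inv\<^bsub>G\<^esub> g))),
      ActMor = (\<lambda>g (M, f, N). mor (twist (\<phi> (inv\<^bsub>G\<^esub> g)) M) f (twist (\<phi> (inv\<^bsub>G\<^esub> g)) N)),
      Compositor = (\<lambda>g h M. mor (twist (\<phi> (inv\<^bsub>G\<^esub> g)) (twist (\<phi> (inv\<^bsub>G\<^esub> h)) M))
        (\<lambda>m. act M m (c (inv\<^bsub>G\<^esub> h) (inv\<^bsub>G\<^esub> g)))
        (twist (\<phi> (inv\<^bsub>G\<^esub> (g \<otimes>\<^bsub>G\<^esub> h))) M))\<rparr>"


section \<open>The Klein four-group acting weakly on the group algebra of order two\<close>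

abbreviation Z2 :: "int monoid" where
  "Z2 \<equiv> integer_mod_group 2"

abbreviation Klein4 :: "(int \<times> int) monoid" where
  "Klein4 \<equiv> Z2 \<times>\<times> Z2"

definition t1 :: "int \<times> int" where "t1 = (1, 0)"
definition t2 :: "int \<times> int" where "t2 = (0, 1)"
definition t12 :: "int \<times> int" where "t12 = t1 \<otimes>\<^bsub>Klein4\<^esub> t2"

definition A\<^sub>0 :: "(complex, int \<Rightarrow> complex) hopf" where
  "A\<^sub>0 = group_hopf_algebra Z2"

definition \<phi>\<^sub>0 :: "int \<times> int \<Rightarrow> (int \<Rightarrow> complex) \<Rightarrow> (int \<Rightarrow> complex)" where
  "\<phi>\<^sub>0 g = (\<lambda>a. a)"

text \<open>\<^term>\<open>group_elem 1\<close> is the nontrivial group element \<open>t\<close>, as \<^term>\<open>Z2\<close> is written additively.\<close>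

definition c\<^sub>0 :: "int \<times> int \<Rightarrow> int \<times> int \<Rightarrow> (int \<Rightarrow> complex)" where
  "c\<^sub>0 g h = (if (g, h) \<in> {(t1, t1), (t2, t1), (t1, t12), (t2, t12)} then group_elem 1 else \<one>\<^bsub>A\<^sub>0\<^esub>)"

end

theory Submission
  imports Defs
begin

text \<open>
  The obstruction is visible on a single module, the sign representation \<open>\<sigma>\<close> of the group of order two.
  Every \<open>\<phi>\<^sub>g\<close> is the identity, so \<open>\<^sup>g\<sigma> = \<sigma>\<close>, and the compositor \<open>\<alpha>\<^sub>g\<^sub>,\<^sub>h(\<sigma>)\<close> is multiplication by the
  scalar \<open>\<omega>(g, h)\<close> by which \<open>c\<close> at \<open>(h\<inverse>, g\<inverse>)\<close> acts on \<open>\<sigma>\<close>. This scalar is not symmetric: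
  \<open>\<omega>(t\<^sub>1, t\<^sub>2) = -1\<close>, but \<open>\<omega>(t\<^sub>2, t\<^sub>1) = 1\<close> (\<open>sign_compositors\<close>).

  Let \<open>F\<close> be an equivalence to the modules over a Hopf algebra \<open>B\<close> with a strict action. The module
  \<open>F \<sigma>\<close> and all its twists have the same underlying vector space, so each \<open>\<psi>\<^sub>g(\<sigma>)\<close> is a linear
  automorphism \<open>p\<^sub>g\<close> of this one space. As the compositors of \<open>B\<close> are identities and \<open>F\<close> is
  \<open>\<complex>\<close>-linear, the coherence condition reads \<open>\<omega>(g, h) p\<^sub>g\<^sub>h = p\<^sub>h p\<^sub>g\<close>. If \<open>p\<^sub>g\<close> and \<open>p\<^sub>h\<close> commute, then
  commutativity of the Klein four-group gives \<open>\<omega>(g, h) = \<omega>(h, g)\<close>, a contradiction.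

  They commute because \<open>F \<sigma>\<close> is one-dimensional. Since \<open>\<sigma> \<otimes> \<sigma>\<close> is isomorphic to the tensor unit
  (\<open>right_module_tensor_line_modules\<close>) and \<open>F\<close> is monoidal, \<open>F \<sigma> \<otimes> F \<sigma>\<close> is isomorphic to the unit of
  the target, hence a line, and a vector space whose tensor square is a line is a line
  (\<open>one_dimensional_if_tensor_square\<close>).
\<close>

section \<open>Linear maps\<close>

lemma field_algebra_simps [simp]:
  "carrier field_algebra = UNIV" "x \<otimes>\<^bsub>field_algebra\<^esub> y = x * y" "\<one>\<^bsub>field_algebra\<^esub> = 1"
  "\<zero>\<^bsub>field_algebra\<^esub> = 0" "x \<oplus>\<^bsub>field_algebra\<^esub> y = x + y" "s \<odot>\<^bsub>field_algebra\<^esub> x = s * x"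
  by (simp_all add: field_algebra_def)

lemma cring_field_algebra: "cring (field_algebra :: ('k::field, 'k) module)"
  by (intro cringI abelian_groupI comm_monoidI)
    (auto simp: algebra_simps intro: exI [of _ "- x" for x])

lemma vector_space_onI:
  fixes V :: "('k::field, 'a, 'm) module_scheme"
  assumes "abelian_group V"
    and "\<And>s x. x \<in> carrier V \<Longrightarrow> s \<odot>\<^bsub>V\<^esub> x \<in> carrier V"
    and "\<And>s r x. x \<in> carrier V \<Longrightarrow> (s + r) \<odot>\<^bsub>V\<^esub> x = s \<odot>\<^bsub>V\<^esub> x \<oplus>\<^bsub>V\<^esub> r \<odot>\<^bsub>V\<^esub> x"
    and "\<And>s x y. x \<in> carrier V \<Longrightarrow> y \<in> carrier V \<Longrightarrow> s \<odot>\<^bsub>V\<^esub> (x \<oplus>\<^bsub>V\<^esub> y) = s \<odot>\<^bsub>V\<^esub> x \<oplus>\<^bsub>V\<^esub> s \<odot>\<^bsub>V\<^esub> y"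
    and "\<And>s r x. x \<in> carrier V \<Longrightarrow> (s * r) \<odot>\<^bsub>V\<^esub> x = s \<odot>\<^bsub>V\<^esub> (r \<odot>\<^bsub>V\<^esub> x)"
    and "\<And>x. x \<in> carrier V \<Longrightarrow> 1 \<odot>\<^bsub>V\<^esub> x = x"
  shows "vector_space_on V"
  by (intro moduleI cring_field_algebra) (use assms in auto)

lemma vector_space_onD:
  fixes V :: "('k::field, 'a, 'm) module_scheme"
  assumes "vector_space_on V"
  shows "abelian_group V"
    and "\<And>s x. x \<in> carrier V \<Longrightarrow> s \<odot>\<^bsub>V\<^esub> x \<in> carrier V"
    and "\<And>s r x. x \<in> carrier V \<Longrightarrow> (s + r) \<odot>\<^bsub>V\<^esub> x = s \<odot>\<^bsub>V\<^esub> x \<oplus>\<^bsub>V\<^esub> r \<odot>\<^bsub>V\<^esub> x"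
    and "\<And>s x y. x \<in> carrier V \<Longrightarrow> y \<in> carrier V \<Longrightarrow> s \<odot>\<^bsub>V\<^esub> (x \<oplus>\<^bsub>V\<^esub> y) = s \<odot>\<^bsub>V\<^esub> x \<oplus>\<^bsub>V\<^esub> s \<odot>\<^bsub>V\<^esub> y"
    and "\<And>s r x. x \<in> carrier V \<Longrightarrow> (s * r) \<odot>\<^bsub>V\<^esub> x = s \<odot>\<^bsub>V\<^esub> (r \<odot>\<^bsub>V\<^esub> x)"
    and "\<And>x. x \<in> carrier V \<Longrightarrow> 1 \<odot>\<^bsub>V\<^esub> x = x"
    and "\<And>x. x \<in> carrier V \<Longrightarrow> 0 \<odot>\<^bsub>V\<^esub> x = \<zero>\<^bsub>V\<^esub>"
    and "\<And>s. s \<odot>\<^bsub>V\<^esub> \<zero>\<^bsub>V\<^esub> = \<zero>\<^bsub>V\<^esub>"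
proof -
  interpret V: module "field_algebra :: ('k, 'k) module" V by fact
  show "abelian_group V" by unfold_locales
  show "\<And>s x. x \<in> carrier V \<Longrightarrow> s \<odot>\<^bsub>V\<^esub> x \<in> carrier V" by simp
  show "\<And>s r x. x \<in> carrier V \<Longrightarrow> (s + r) \<odot>\<^bsub>V\<^esub> x = s \<odot>\<^bsub>V\<^esub> x \<oplus>\<^bsub>V\<^esub> r \<odot>\<^bsub>V\<^esub> x"
    using V.smult_l_distr by simp
  show "\<And>s x y. x \<in> carrier V \<Longrightarrow> y \<in> carrier V \<Longrightarrow> s \<odot>\<^bsub>V\<^esub> (x \<oplus>\<^bsub>V\<^esub> y) = s \<odot>\<^bsub>V\<^esub> x \<oplus>\<^bsub>V\<^esub> s \<odot>\<^bsub>V\<^esub> y"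
    using V.smult_r_distr by simp
  show "\<And>s r x. x \<in> carrier V \<Longrightarrow> (s * r) \<odot>\<^bsub>V\<^esub> x = s \<odot>\<^bsub>V\<^esub> (r \<odot>\<^bsub>V\<^esub> x)"
    using V.smult_assoc1 by simp
  show "\<And>x. x \<in> carrier V \<Longrightarrow> 1 \<odot>\<^bsub>V\<^esub> x = x"
    using V.smult_one by simp
  show "\<And>x. x \<in> carrier V \<Longrightarrow> 0 \<odot>\<^bsub>V\<^esub> x = \<zero>\<^bsub>V\<^esub>"
    using V.smult_l_null by simp
  show "\<And>s. s \<odot>\<^bsub>V\<^esub> \<zero>\<^bsub>V\<^esub> = \<zero>\<^bsub>V\<^esub>"
    using V.smult_r_null by simp
qed

lemma vector_space_on_field_algebra: "vector_space_on (field_algebra :: ('k::field, 'k) module)"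
  by (rule vector_space_onI)
    (simp_all add: algebra_simps cring.axioms(1) [OF cring_field_algebra] ring.is_abelian_group)

lemma linear_onI:
  assumes "\<And>x. x \<in> carrier V \<Longrightarrow> f x \<in> carrier W"
    and "\<And>x y. x \<in> carrier V \<Longrightarrow> y \<in> carrier V \<Longrightarrow> f (x \<oplus>\<^bsub>V\<^esub> y) = f x \<oplus>\<^bsub>W\<^esub> f y"
    and "\<And>s x. x \<in> carrier V \<Longrightarrow> f (s \<odot>\<^bsub>V\<^esub> x) = s \<odot>\<^bsub>W\<^esub> f x"
  shows "linear_on V W f"
  using assms by (auto simp: linear_on_def)

lemma linear_onD:
  assumes "linear_on V W f"
  shows "\<And>x. x \<in> carrier V \<Longrightarrow> f x \<in> carrier W"
    and "\<And>x y. x \<in> carrier V \<Longrightarrow> y \<in> carrier V \<Longrightarrow> f (x \<oplus>\<^bsub>V\<^esub> y) = f x \<oplus>\<^bsub>W\<^esub> f y"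
    and "\<And>s x. x \<in> carrier V \<Longrightarrow> f (s \<odot>\<^bsub>V\<^esub> x) = s \<odot>\<^bsub>W\<^esub> f x"
  using assms by (auto simp: linear_on_def)

lemma linear_on_zero:
  fixes V :: "('k::field, 'a, 'm) module_scheme" and W :: "('k, 'b, 'n) module_scheme"
  assumes "vector_space_on V" "vector_space_on W" "linear_on V W f"
  shows "f \<zero>\<^bsub>V\<^esub> = \<zero>\<^bsub>W\<^esub>"
proof -
  have z: "\<zero>\<^bsub>V\<^esub> \<in> carrier V"
    using abelian_groupE(2) [OF vector_space_onD(1) [OF assms(1)]] .
  have "f \<zero>\<^bsub>V\<^esub> = f (0 \<odot>\<^bsub>V\<^esub> \<zero>\<^bsub>V\<^esub>)"
    using z assms(1) by (simp add: vector_space_onD)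
  also have "\<dots> = 0 \<odot>\<^bsub>W\<^esub> f \<zero>\<^bsub>V\<^esub>"
    using z assms(3) by (simp add: linear_onD)
  also have "\<dots> = \<zero>\<^bsub>W\<^esub>"
    using linear_onD(1) [OF assms(3) z] assms(2) by (simp add: vector_space_onD)
  finally show ?thesis .
qed

lemma linear_on_comp:
  assumes "linear_on U V f" "linear_on V W h"
  shows "linear_on U W (h \<circ> f)"
  using assms by (auto simp: linear_on_def Pi_def)

definition linear_iso_on ::
  "('k, 'a, 'm) module_scheme \<Rightarrow> ('k, 'b, 'n) module_scheme \<Rightarrow> ('a \<Rightarrow> 'b) \<Rightarrow> bool" where
  "linear_iso_on V W f \<longleftrightarrow> linear_on V W f \<and> bij_betw f (carrier V) (carrier W)"

lemma linear_iso_on_comp: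
  assumes "linear_iso_on U V f" "linear_iso_on V W h"
  shows "linear_iso_on U W (h \<circ> f)"
  using assms by (auto simp: linear_iso_on_def intro: linear_on_comp bij_betw_trans)

lemma linear_iso_on_inv_into:
  fixes V :: "('k::field, 'a, 'm) module_scheme"
  assumes "vector_space_on V" "linear_iso_on V W f"
  shows "linear_iso_on W V (inv_into (carrier V) f)"
proof -
  let ?h = "inv_into (carrier V) f"
  have f: "linear_on V W f" and b: "bij_betw f (carrier V) (carrier W)"
    using assms(2) by (auto simp: linear_iso_on_def)
  have h: "bij_betw ?h (carrier W) (carrier V)"
    using b by (rule bij_betw_inv_into)
  have hV: "?h y \<in> carrier V" and fh: "f (?h y) = y" if "y \<in> carrier W" for y
    using that h b by (auto simp: bij_betw_apply bij_betw_inv_into_right)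
  have hf: "?h (f x) = x" if "x \<in> carrier V" for x
    using that b by (simp add: bij_betw_inv_into_left)
  have "linear_on W V ?h"
  proof (rule linear_onI)
    fix x y assume "x \<in> carrier W" "y \<in> carrier W"
    then show "?h (x \<oplus>\<^bsub>W\<^esub> y) = ?h x \<oplus>\<^bsub>V\<^esub> ?h y"
      using linear_onD(2) [OF f hV hV, of x y] hf [of "?h x \<oplus>\<^bsub>V\<^esub> ?h y"] hV fh
        abelian_groupE(1) [OF vector_space_onD(1) [OF assms(1)]] by simp
  next
    fix s x assume "x \<in> carrier W"
    then show "?h (s \<odot>\<^bsub>W\<^esub> x) = s \<odot>\<^bsub>V\<^esub> ?h x"
      using linear_onD(3) [OF f hV, of x s] hf [of "s \<odot>\<^bsub>V\<^esub> ?h x"] hV fh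
        vector_space_onD(2) [OF assms(1)] by simp
  qed (fact hV)
  with h show ?thesis by (simp add: linear_iso_on_def)
qed

lemma linear_functional_finsum:
  fixes V :: "('k::field, 'a, 'm) module_scheme"
  assumes V: "abelian_monoid V" and l: "linear_on V field_algebra l" and l0: "l \<zero>\<^bsub>V\<^esub> = 0"
    and "finite S" "u \<in> S \<rightarrow> carrier V"
  shows "l (\<Oplus>\<^bsub>V\<^esub>x\<in>S. u x) = (\<Sum>x\<in>S. l (u x))"
proof -
  interpret abelian_monoid V by fact
  show ?thesis using assms(4,5)
  proof (induction S)
    case empty
    then show ?case using l0 by simp
  next
    case (insert x S)
    then have "u \<in> S \<rightarrow> carrier V" "u x \<in> carrier V" by auto
    then show ?case
      using insert linear_onD(2) [OF l, of "u x" "finsum V u S"] by (simp add: finsum_closed)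
  qed
qed


section \<open>Bilinear maps and tensor products\<close>

definition bilinear_on ::
  "('k, 'a, 'm) module_scheme \<Rightarrow> ('k, 'b, 'n) module_scheme \<Rightarrow> ('k, 'c, 'r) module_scheme \<Rightarrow>
    ('a \<Rightarrow> 'b \<Rightarrow> 'c) \<Rightarrow> bool" where
  "bilinear_on V W Z f \<longleftrightarrow> (\<forall>x\<in>carrier V. linear_on W Z (f x)) \<and> (\<forall>y\<in>carrier W. linear_on V Z (\<lambda>x. f x y))"

lemma tensor_lift_simps [simp]:
  "tensor_lift Z f [] = \<zero>\<^bsub>Z\<^esub>"
  "tensor_lift Z f ((x, y) # u) = f x y \<oplus>\<^bsub>Z\<^esub> tensor_lift Z f u"
  by (simp_all add: tensor_lift_def)

lemma tensor_lift_field_algebra: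
  "tensor_lift field_algebra f u = (\<Sum>(x, y)\<leftarrow>u. f x y)"
  by (induction u) auto

locale vector_space_pair =
  fixes V :: "('k::field, 'a, 'm) module_scheme" and W :: "('k, 'b, 'n) module_scheme"
  assumes V: "vector_space_on V" and W: "vector_space_on W"
begin

lemma tensor_eq_carrier:
  assumes "tensor_eq V W xs ys"
  shows "set xs \<subseteq> carrier V \<times> carrier W" "set ys \<subseteq> carrier V \<times> carrier W"
  using assms
  by (induction) (use V W in \<open>auto simp: vector_space_onD(2) abelian_groupE(1,2) [OF vector_space_onD(1)]\<close>)

lemma tsum_cong: "tensor_eq V W xs ys \<Longrightarrow> tsum V W xs = tsum V W ys"
  unfolding tsum_def by (rule arg_cong [where f = Eps]) (blast intro: tensor_eq.sym tensor_eq.trans)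

lemma tensor_eq_tsum: "set xs \<subseteq> carrier V \<times> carrier W \<Longrightarrow> tensor_eq V W xs (tsum V W xs)"
  unfolding tsum_def by (rule someI) (rule tensor_eq.refl)

lemma tsum_tsum: "set xs \<subseteq> carrier V \<times> carrier W \<Longrightarrow> tsum V W (tsum V W xs) = tsum V W xs"
  using tensor_eq_tsum tsum_cong by metis

lemma carrier_tensorD:
  assumes "u \<in> carrier (tensor V W)"
  shows "set u \<subseteq> carrier V \<times> carrier W" "tsum V W u = u"
proof -
  obtain xs where xs: "set xs \<subseteq> carrier V \<times> carrier W" "u = tsum V W xs"
    using assms by (auto simp: tensor_def)
  show "set u \<subseteq> carrier V \<times> carrier W"
    using tensor_eq_carrier(2) [OF tensor_eq_tsum] xs by blast
  show "tsum V W u = u" using tsum_tsum xs by blast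
qed

lemma tsum_in_carrier: "set xs \<subseteq> carrier V \<times> carrier W \<Longrightarrow> tsum V W xs \<in> carrier (tensor V W)"
  by (auto simp: tensor_def)

lemma tensor_add:
  assumes "set xs \<subseteq> carrier V \<times> carrier W" "set ys \<subseteq> carrier V \<times> carrier W"
  shows "tsum V W xs \<oplus>\<^bsub>tensor V W\<^esub> tsum V W ys = tsum V W (xs @ ys)"
  unfolding tensor_def
  by simp (intro tsum_cong tensor_eq.append tensor_eq.sym [OF tensor_eq_tsum] assms)

text \<open>
  Scaling the left entries of a formal sum respects bilinear congruence; for the rule that moves a
  scalar \<open>r\<close> across the tensor sign this is commutativity of the field.
\<close>

lemma tensor_smult_cong:
  assumes "tensor_eq V W xs ys"
  shows "tensor_eq V W (map (\<lambda>(x, y). (s \<odot>\<^bsub>V\<^esub> x, y)) xs) (map (\<lambda>(x, y). (s \<odot>\<^bsub>V\<^esub> x, y)) ys)"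
  using assms
proof (induction)
  case (refl xs)
  then show ?case using vector_space_onD(2) [OF V] by (intro tensor_eq.refl) auto
next
  case (sym xs ys)
  then show ?case by (rule_tac tensor_eq.sym)
next
  case (trans xs ys zs)
  then show ?case using tensor_eq.trans by blast
next
  case (append xs xs' ys ys')
  then show ?case by (simp add: tensor_eq.append)
next
  case (comm xs ys)
  then show ?case
    using vector_space_onD(2) [OF V] by simp (intro tensor_eq.comm; auto)
next
  case (add_left x x' y)
  then show ?case
    using vector_space_onD(2) [OF V] vector_space_onD(4) [OF V] by (simp add: tensor_eq.add_left)
next
  case (add_right x y y')
  then show ?case using vector_space_onD(2) [OF V] by (simp add: tensor_eq.add_right)
next
  case (smult x y r)
  have "s \<odot>\<^bsub>V\<^esub> (r \<odot>\<^bsub>V\<^esub> x) = r \<odot>\<^bsub>V\<^esub> (s \<odot>\<^bsub>V\<^esub> x)"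
    using smult vector_space_onD(5) [OF V, of x s r] vector_space_onD(5) [OF V, of x r s]
    by (simp add: mult.commute)
  then show ?case
    using smult vector_space_onD(2) [OF V] tensor_eq.smult [of "s \<odot>\<^bsub>V\<^esub> x" V y W r] by simp
next
  case (zero y)
  then show ?case using vector_space_onD(8) [OF V] by (simp add: tensor_eq.zero)
qed

lemma tensor_smult:
  assumes "set xs \<subseteq> carrier V \<times> carrier W"
  shows "s \<odot>\<^bsub>tensor V W\<^esub> tsum V W xs = tsum V W (map (\<lambda>(x, y). (s \<odot>\<^bsub>V\<^esub> x, y)) xs)"
  unfolding tensor_def
  using tsum_cong [OF tensor_eq.sym [OF tensor_smult_cong [OF tensor_eq_tsum [OF assms]]]] by simp

lemma abelian_monoid_tensor: "abelian_monoid (tensor V W)"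
proof -
  have c: "\<exists>xs. u = tsum V W xs \<and> set xs \<subseteq> carrier V \<times> carrier W" if "u \<in> carrier (tensor V W)" for u
    using that by (auto simp: tensor_def)
  have z: "\<zero>\<^bsub>tensor V W\<^esub> = tsum V W []" by (simp add: tensor_def)
  show ?thesis
  proof (rule abelian_monoidI)
    fix u v assume "u \<in> carrier (tensor V W)" "v \<in> carrier (tensor V W)"
    then obtain xs ys where xs: "u = tsum V W xs" "set xs \<subseteq> carrier V \<times> carrier W"
      and ys: "v = tsum V W ys" "set ys \<subseteq> carrier V \<times> carrier W" using c by meson
    then show "u \<oplus>\<^bsub>tensor V W\<^esub> v \<in> carrier (tensor V W)"
      by (simp add: tensor_add tsum_in_carrier)
    show "u \<oplus>\<^bsub>tensor V W\<^esub> v = v \<oplus>\<^bsub>tensor V W\<^esub> u"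
      using xs ys by (simp add: tensor_add tsum_cong [OF tensor_eq.comm])
  next
    fix u v w assume "u \<in> carrier (tensor V W)" "v \<in> carrier (tensor V W)" "w \<in> carrier (tensor V W)"
    then obtain xs ys zs where "u = tsum V W xs" "set xs \<subseteq> carrier V \<times> carrier W"
      "v = tsum V W ys" "set ys \<subseteq> carrier V \<times> carrier W"
      "w = tsum V W zs" "set zs \<subseteq> carrier V \<times> carrier W" using c by meson
    then show "u \<oplus>\<^bsub>tensor V W\<^esub> v \<oplus>\<^bsub>tensor V W\<^esub> w = u \<oplus>\<^bsub>tensor V W\<^esub> (v \<oplus>\<^bsub>tensor V W\<^esub> w)"
      by (simp add: tensor_add)
  next
    fix u assume "u \<in> carrier (tensor V W)"
    then obtain xs where "u = tsum V W xs" "set xs \<subseteq> carrier V \<times> carrier W" using c by meson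
    then show "\<zero>\<^bsub>tensor V W\<^esub> \<oplus>\<^bsub>tensor V W\<^esub> u = u" by (simp add: tensor_add z)
  qed (simp add: z tsum_in_carrier)
qed

lemma tensor_lift_closed:
  assumes Z: "vector_space_on Z" and f: "bilinear_on V W Z f" and "set xs \<subseteq> carrier V \<times> carrier W"
  shows "tensor_lift Z f xs \<in> carrier Z"
  using assms(3)
proof (induction xs)
  case Nil
  then show ?case using abelian_groupE(2) [OF vector_space_onD(1) [OF Z]] by simp
next
  case (Cons p xs)
  then show ?case
    using abelian_groupE(1) [OF vector_space_onD(1) [OF Z]] f
    by (cases p) (auto simp: bilinear_on_def linear_onD(1))
qed

lemma tensor_lift_append:
  assumes Z: "vector_space_on Z" and f: "bilinear_on V W Z f"
    and "set xs \<subseteq> carrier V \<times> carrier W" and ys: "set ys \<subseteq> carrier V \<times> carrier W"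
  shows "tensor_lift Z f (xs @ ys) = tensor_lift Z f xs \<oplus>\<^bsub>Z\<^esub> tensor_lift Z f ys"
  using assms(3)
proof (induction xs)
  case Nil
  then show ?case
    using abelian_groupE(5) [OF vector_space_onD(1) [OF Z]] tensor_lift_closed [OF Z f ys] by simp
next
  case (Cons p xs)
  then show ?case
    using abelian_groupE(3) [OF vector_space_onD(1) [OF Z]] f
      tensor_lift_closed [OF Z f ys] tensor_lift_closed [OF Z f, of xs]
    by (cases p) (auto simp: bilinear_on_def linear_onD(1))
qed

text \<open>
  The universal property: a bilinear map takes equal values on congruent formal sums, since each
  generating rule of the congruence is an instance of bilinearity or of the group laws of the target.
  Elements of a tensor product are chosen representatives, so this is the only access to their value.
\<close>

lemma tensor_lift_cong:
  assumes Z: "vector_space_on Z" and f: "bilinear_on V W Z f" and "tensor_eq V W xs ys"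
  shows "tensor_lift Z f xs = tensor_lift Z f ys"
proof -
  interpret Z: abelian_group Z by (rule vector_space_onD(1) [OF Z])
  have l: "\<And>x. x \<in> carrier V \<Longrightarrow> linear_on W Z (f x)"
    and r: "\<And>y. y \<in> carrier W \<Longrightarrow> linear_on V Z (\<lambda>x. f x y)"
    using f by (auto simp: bilinear_on_def)
  have c: "\<And>x y. x \<in> carrier V \<Longrightarrow> y \<in> carrier W \<Longrightarrow> f x y \<in> carrier Z"
    using l by (rule linear_onD(1))
  show ?thesis using assms(3)
  proof (induction)
    case (append xs xs' ys ys')
    then show ?case
      using tensor_lift_append [OF Z f] tensor_eq_carrier by metis
  next
    case (comm xs ys)
    then show ?case
      using tensor_lift_append [OF Z f] tensor_lift_closed [OF Z f] Z.a_comm by simp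
  next
    case (add_left x x' y)
    then show ?case using linear_onD(2) [OF r] c by (simp add: Z.a_assoc)
  next
    case (add_right x y y')
    then show ?case using linear_onD(2) [OF l] c by (simp add: Z.a_assoc)
  next
    case (smult x y s)
    then show ?case using linear_onD(3) [OF l] linear_onD(3) [OF r] c by simp
  next
    case (zero y)
    then show ?case using linear_on_zero [OF V Z r] by simp
  qed auto
qed

lemma tensor_lift_tsum:
  assumes "vector_space_on Z" "bilinear_on V W Z f" "set xs \<subseteq> carrier V \<times> carrier W"
  shows "tensor_lift Z f (tsum V W xs) = tensor_lift Z f xs"
  using tensor_lift_cong [OF assms(1,2) tensor_eq_tsum [OF assms(3)]] by simp

lemma linear_on_tensor_lift:
  assumes Z: "vector_space_on Z" and f: "bilinear_on V W Z f"
  shows "linear_on (tensor V W) Z (tensor_lift Z f)"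
proof (rule linear_onI)
  fix u assume u: "u \<in> carrier (tensor V W)"
  then show "tensor_lift Z f u \<in> carrier Z"
    using tensor_lift_closed [OF Z f] carrier_tensorD by blast
  fix s
  have *: "tensor_lift Z f (map (\<lambda>(x, y). (s \<odot>\<^bsub>V\<^esub> x, y)) xs) = s \<odot>\<^bsub>Z\<^esub> tensor_lift Z f xs"
    if "set xs \<subseteq> carrier V \<times> carrier W" for xs
    using that
  proof (induction xs)
    case Nil
    then show ?case using vector_space_onD(8) [OF Z] by simp
  next
    case (Cons p xs)
    obtain x y where p: "p = (x, y)" by (cases p)
    have xy: "x \<in> carrier V" "y \<in> carrier W" using Cons.prems p by auto
    then have "f (s \<odot>\<^bsub>V\<^esub> x) y = s \<odot>\<^bsub>Z\<^esub> f x y" "f x y \<in> carrier Z"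
      using f linear_onD(3) [of V Z "\<lambda>x. f x y" x s]
      by (auto simp: bilinear_on_def linear_onD(1))
    then show ?case
      using Cons p vector_space_onD(4) [OF Z] tensor_lift_closed [OF Z f, of xs] by simp
  qed
  have "s \<odot>\<^bsub>tensor V W\<^esub> u = tsum V W (map (\<lambda>(x, y). (s \<odot>\<^bsub>V\<^esub> x, y)) u)"
    using tensor_smult carrier_tensorD [OF u] by metis
  moreover have "set (map (\<lambda>(x, y). (s \<odot>\<^bsub>V\<^esub> x, y)) u) \<subseteq> carrier V \<times> carrier W"
    using carrier_tensorD(1) [OF u] vector_space_onD(2) [OF V] by auto
  ultimately show "tensor_lift Z f (s \<odot>\<^bsub>tensor V W\<^esub> u) = s \<odot>\<^bsub>Z\<^esub> tensor_lift Z f u"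
    using * [OF carrier_tensorD(1) [OF u]] tensor_lift_tsum [OF Z f] by simp
next
  fix u v assume uv: "u \<in> carrier (tensor V W)" "v \<in> carrier (tensor V W)"
  then have "u \<oplus>\<^bsub>tensor V W\<^esub> v = tsum V W (u @ v)"
    using tensor_add carrier_tensorD by metis
  then show "tensor_lift Z f (u \<oplus>\<^bsub>tensor V W\<^esub> v) = tensor_lift Z f u \<oplus>\<^bsub>Z\<^esub> tensor_lift Z f v"
    using uv carrier_tensorD(1) tensor_lift_tsum [OF Z f, of "u @ v"] tensor_lift_append [OF Z f]
    by simp
qed

lemma bilinear_on_tsum:
  "bilinear_on V W (tensor V W) (\<lambda>x y. tsum V W [(x, y)])"
  unfolding bilinear_on_def
proof (intro conjI ballI linear_onI)
  fix x y s assume xy: "x \<in> carrier V" "y \<in> carrier W"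
  show l: "tsum V W [(s \<odot>\<^bsub>V\<^esub> x, y)] = s \<odot>\<^bsub>tensor V W\<^esub> tsum V W [(x, y)]"
    using xy by (simp add: tensor_smult)
  have "tensor_eq V W [(x, s \<odot>\<^bsub>W\<^esub> y)] [(s \<odot>\<^bsub>V\<^esub> x, y)]"
    using xy by (intro tensor_eq.sym [OF tensor_eq.smult])
  then show "tsum V W [(x, s \<odot>\<^bsub>W\<^esub> y)] = s \<odot>\<^bsub>tensor V W\<^esub> tsum V W [(x, y)]"
    using l tsum_cong by metis
qed (simp_all add: tsum_in_carrier tensor_add tsum_cong [OF tensor_eq.add_left]
  tsum_cong [OF tensor_eq.add_right])

end

lemma bilinear_on_comp:
  assumes "bilinear_on V W Z f" "linear_on Z Y h"
  shows "bilinear_on V W Y (\<lambda>x y. h (f x y))"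
  unfolding bilinear_on_def
proof (intro conjI ballI)
  fix x assume "x \<in> carrier V"
  then show "linear_on W Y (\<lambda>y. h (f x y))"
    using assms linear_on_comp [of W Z "f x" Y h] by (simp add: bilinear_on_def o_def)
next
  fix y assume "y \<in> carrier W"
  then show "linear_on V Y (\<lambda>x. h (f x y))"
    using assms linear_on_comp [of V Z "\<lambda>x. f x y" Y h] by (simp add: bilinear_on_def o_def)
qed

text \<open>
  The isomorphism \<open>ev\<close> itself supplies the functionals that detect linear dependence: it is a bilinear
  form \<open>b x y = ev (x \<otimes> y)\<close>, nonzero at some \<open>(x\<^sub>0, y\<^sub>0)\<close>.
  All tensors are proportional, and contracting the left factor of
  \<open>b x\<^sub>0 y\<^sub>0 \<cdot> (y\<^sub>0 \<otimes> y) = b y\<^sub>0 y \<cdot> (x\<^sub>0 \<otimes> y\<^sub>0)\<close> with \<open>b x\<^sub>0\<close> exhibits \<open>y\<close> as a multiple of \<open>y\<^sub>0\<close>.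
\<close>

lemma one_dimensional_if_tensor_square:
  fixes V :: "('k::field, 'a, 'm) module_scheme"
  assumes V: "vector_space_on V" and ev: "linear_iso_on (tensor V V) field_algebra ev"
  obtains e where "e \<in> carrier V" "e \<noteq> \<zero>\<^bsub>V\<^esub>" "\<And>x. x \<in> carrier V \<Longrightarrow> \<exists>s. x = s \<odot>\<^bsub>V\<^esub> e"
proof -
  interpret vector_space_pair V V by (rule vector_space_pair.intro) (fact V)+
  note F = vector_space_on_field_algebra
  let ?T = "tensor V V"
  define t where "t x y = tsum V V [(x, y)]" for x y
  define b where "b x y = ev (t x y)" for x y
  have lin: "linear_on ?T field_algebra ev" and bij: "bij_betw ev (carrier ?T) UNIV"
    using ev by (simp_all add: linear_iso_on_def)
  have b: "bilinear_on V V field_algebra b"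
    unfolding b_def t_def by (rule bilinear_on_comp [OF bilinear_on_tsum lin])
  have t_carrier: "t x y \<in> carrier ?T" if "x \<in> carrier V" "y \<in> carrier V" for x y
    using that by (simp add: t_def tsum_in_carrier)
  have z: "\<zero>\<^bsub>?T\<^esub> \<in> carrier ?T" "\<zero>\<^bsub>?T\<^esub> \<oplus>\<^bsub>?T\<^esub> \<zero>\<^bsub>?T\<^esub> = \<zero>\<^bsub>?T\<^esub>"
    using abelian_monoidE(2,4) [OF abelian_monoid_tensor] by auto
  have ev0: "ev \<zero>\<^bsub>?T\<^esub> = 0"
    using linear_onD(2) [OF lin z(1) z(1)] z(2) by (metis add.right_neutral add_left_imp_eq field_algebra_simps(5))
  \<comment> \<open>Otherwise \<open>ev\<close> would vanish on all formal sums, although it is onto.\<close>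
  obtain x\<^sub>0 y\<^sub>0 where xy0: "x\<^sub>0 \<in> carrier V" "y\<^sub>0 \<in> carrier V" "b x\<^sub>0 y\<^sub>0 \<noteq> 0"
  proof (rule ccontr)
    assume "\<not> thesis"
    then have b0: "\<And>x y. x \<in> carrier V \<Longrightarrow> y \<in> carrier V \<Longrightarrow> b x y = 0" using that by blast
    have "ev (tsum V V xs) = 0" if "set xs \<subseteq> carrier V \<times> carrier V" for xs
      using that
    proof (induction xs)
      case Nil
      then show ?case using ev0 by (simp add: tensor_def)
    next
      case (Cons p xs)
      obtain x y where p: "p = (x, y)" by (cases p)
      have "tsum V V (p # xs) = t x y \<oplus>\<^bsub>?T\<^esub> tsum V V xs"
        using Cons.prems p tensor_add [of "[(x, y)]" xs] by (simp add: t_def)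
      then show ?case
        using Cons p b0 [of x y] linear_onD(2) [OF lin, of "t x y" "tsum V V xs"]
        by (simp add: t_carrier tsum_in_carrier b_def)
    qed
    then have "ev u = 0" if "u \<in> carrier ?T" for u
      using that by (auto simp: tensor_def)
    then have "(1::'k) \<notin> ev ` carrier ?T" by force
    then show False using bij by (simp add: bij_betw_def)
  qed
  \<comment> \<open>As \<open>ev\<close> is injective, any two pure tensors are proportional; the functional \<open>b x\<^sub>0\<close> applied to the
    left factors turns this into proportionality of the right factors.\<close>
  have proportional: "(b x\<^sub>0 y\<^sub>0 * b x\<^sub>0 x) \<odot>\<^bsub>V\<^esub> y = (b x y * b x\<^sub>0 x\<^sub>0) \<odot>\<^bsub>V\<^esub> y\<^sub>0"
    if xy: "x \<in> carrier V" "y \<in> carrier V" for x y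
  proof -
    define l where "l = tensor_lift V (\<lambda>x y. b x\<^sub>0 x \<odot>\<^bsub>V\<^esub> y)"
    have bx: "linear_on V field_algebra (b x\<^sub>0)"
      using b xy0 by (simp add: bilinear_on_def)
    have bil: "bilinear_on V V V (\<lambda>x y. b x\<^sub>0 x \<odot>\<^bsub>V\<^esub> y)"
      unfolding bilinear_on_def
    proof (intro conjI ballI linear_onI)
      fix x y s assume "x \<in> carrier V" "y \<in> carrier V"
      then show "b x\<^sub>0 x \<odot>\<^bsub>V\<^esub> (s \<odot>\<^bsub>V\<^esub> y) = s \<odot>\<^bsub>V\<^esub> (b x\<^sub>0 x \<odot>\<^bsub>V\<^esub> y)"
        by (simp add: mult.commute flip: vector_space_onD(5) [OF V])
    qed (use linear_onD [OF bx] in \<open>auto simp: vector_space_onD [OF V]\<close>)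
    have l: "linear_on ?T V l"
      unfolding l_def by (rule linear_on_tensor_lift [OF V bil])
    have lt: "l (t x y) = b x\<^sub>0 x \<odot>\<^bsub>V\<^esub> y" if "x \<in> carrier V" "y \<in> carrier V" for x y
      using that tensor_lift_tsum [OF V bil, of "[(x, y)]"]
        abelian_monoid.r_zero [OF abelian_group.axioms(1) [OF vector_space_onD(1) [OF V]]]
      by (simp add: l_def t_def vector_space_onD(2) [OF V])
    have s: "s \<odot>\<^bsub>?T\<^esub> t x y \<in> carrier ?T" if "x \<in> carrier V" "y \<in> carrier V" for s x y
      using that vector_space_onD(2) [OF V] by (simp add: t_def tensor_smult tsum_in_carrier)
    have "ev (b x\<^sub>0 y\<^sub>0 \<odot>\<^bsub>?T\<^esub> t x y) = ev (b x y \<odot>\<^bsub>?T\<^esub> t x\<^sub>0 y\<^sub>0)"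
      using linear_onD(3) [OF lin] xy xy0 by (simp add: t_carrier b_def)
    then have "b x\<^sub>0 y\<^sub>0 \<odot>\<^bsub>?T\<^esub> t x y = b x y \<odot>\<^bsub>?T\<^esub> t x\<^sub>0 y\<^sub>0"
      using bij xy xy0 s by (auto simp: bij_betw_def inj_on_def)
    then have "b x\<^sub>0 y\<^sub>0 \<odot>\<^bsub>V\<^esub> l (t x y) = b x y \<odot>\<^bsub>V\<^esub> l (t x\<^sub>0 y\<^sub>0)"
      using linear_onD(3) [OF l] t_carrier xy xy0 by metis
    then show ?thesis
      using xy xy0 by (simp add: lt vector_space_onD(5) [OF V])
  qed
  \<comment> \<open>Taking \<open>x = y\<^sub>0\<close> makes the coefficient of \<open>y\<close> the invertible scalar \<open>(b x\<^sub>0 y\<^sub>0)\<^sup>2\<close>.\<close>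
  have "\<exists>s. y = s \<odot>\<^bsub>V\<^esub> y\<^sub>0" if y: "y \<in> carrier V" for y
  proof
    let ?c = "b x\<^sub>0 y\<^sub>0 * b x\<^sub>0 y\<^sub>0"
    have "y = (1 / ?c * ?c) \<odot>\<^bsub>V\<^esub> y"
      using xy0(3) y by (simp add: vector_space_onD [OF V])
    also have "\<dots> = (1 / ?c) \<odot>\<^bsub>V\<^esub> ((b y\<^sub>0 y * b x\<^sub>0 x\<^sub>0) \<odot>\<^bsub>V\<^esub> y\<^sub>0)"
      using y xy0 by (simp only: vector_space_onD(5) [OF V y] proportional [OF xy0(2) y, symmetric])
    also have "\<dots> = (1 / ?c * (b y\<^sub>0 y * b x\<^sub>0 x\<^sub>0)) \<odot>\<^bsub>V\<^esub> y\<^sub>0"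
      using xy0(2) by (simp only: vector_space_onD(5) [OF V])
    finally show "y = (1 / ?c * (b y\<^sub>0 y * b x\<^sub>0 x\<^sub>0)) \<odot>\<^bsub>V\<^esub> y\<^sub>0" .
  qed
  moreover have "y\<^sub>0 \<noteq> \<zero>\<^bsub>V\<^esub>"
  proof
    assume "y\<^sub>0 = \<zero>\<^bsub>V\<^esub>"
    moreover have "linear_on V field_algebra (b x\<^sub>0)" using b xy0 by (simp add: bilinear_on_def)
    ultimately show False using linear_on_zero [OF V F] xy0(3) by force
  qed
  ultimately show thesis using that xy0(2) by blast
qed

lemma endomorphisms_of_line_commute:
  fixes V :: "('k::field, 'a, 'm) module_scheme"
  assumes V: "vector_space_on V" and e: "e \<in> carrier V"
    and span: "\<And>x. x \<in> carrier V \<Longrightarrow> \<exists>s. x = s \<odot>\<^bsub>V\<^esub> e"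
    and f: "linear_on V V f" and h: "linear_on V V h"
  shows "f (h e) = h (f e)"
proof -
  obtain r s where rs: "f e = r \<odot>\<^bsub>V\<^esub> e" "h e = s \<odot>\<^bsub>V\<^esub> e"
    using span linear_onD(1) [OF f e] linear_onD(1) [OF h e] by meson
  then have "f (h e) = (s * r) \<odot>\<^bsub>V\<^esub> e" "h (f e) = (r * s) \<odot>\<^bsub>V\<^esub> e"
    using e linear_onD(3) [OF f] linear_onD(3) [OF h] by (simp_all add: vector_space_onD(5) [OF V])
  then show ?thesis by (simp add: mult.commute)
qed


section \<open>Lines on which an algebra acts by a character\<close>

text \<open>
  The underlying line is the one of \<^const>\<open>unit_module\<close>, so that the unit is literally the line of
  the counit and both modules of the argument are instances of one construction.
\<close>

definition line_module :: "('a \<Rightarrow> 'k::field) \<Rightarrow> ('k, 'a, 'x) umodule" where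
  "line_module \<chi> =
     \<lparr>carrier = range Scalar,
      mult = undefined,
      one = undefined,
      zero = Scalar 0,
      add = (\<lambda>u v. Scalar (the_scalar u + the_scalar v)),
      smult = (\<lambda>s u. Scalar (s * the_scalar u)),
      act = (\<lambda>u a. Scalar (the_scalar u * \<chi> a))\<rparr>"

lemma unit_module_eq_line_module: "unit_module H = line_module (counit H)"
  by (simp add: unit_module_def line_module_def)

lemma line_module_simps [simp]:
  "carrier (line_module \<chi>) = range Scalar"
  "\<zero>\<^bsub>line_module \<chi>\<^esub> = Scalar 0"
  "u \<oplus>\<^bsub>line_module \<chi>\<^esub> v = Scalar (the_scalar u + the_scalar v)"
  "s \<odot>\<^bsub>line_module \<chi>\<^esub> u = Scalar (s * the_scalar u)"
  "act (line_module \<chi>) u a = Scalar (the_scalar u * \<chi> a)"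
  by (simp_all add: line_module_def)

lemma vector_space_on_line_module: "vector_space_on (line_module \<chi> :: ('k::field, 'a, 'x) umodule)"
  by (intro vector_space_onI abelian_groupI)
    (auto simp: algebra_simps intro: exI [of _ "- x" for x])

lemma linear_iso_on_the_scalar: "linear_iso_on (line_module \<chi>) field_algebra the_scalar"
  unfolding linear_iso_on_def
  by (auto intro!: linear_onI bij_betwI [of _ _ _ Scalar])

lemma right_module_line_module:
  assumes "algebra_hom A field_algebra \<chi>"
  shows "right_module A (line_module \<chi>)"
  using assms vector_space_on_line_module [of \<chi>]
  by (auto simp: right_module_def algebra_hom_def ring_hom_def linear_on_def algebra_simps)

text \<open>
  All module axioms are equations, so they pass to surjective images. This is how tensor products of
  lines are seen to be modules, from the line of the product character that maps onto them.
\<close>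

lemma right_module_image:
  fixes M :: "('k::field, 'a, 'u) rmodule" and N :: "('k, 'a, 'v) rmodule"
  assumes M: "right_module A M" and e: "linear_on M N e" and onto: "e ` carrier M = carrier N"
    and zero: "e \<zero>\<^bsub>M\<^esub> = \<zero>\<^bsub>N\<^esub>"
    and act: "\<And>m a. m \<in> carrier M \<Longrightarrow> a \<in> carrier A \<Longrightarrow> e (act M m a) = act N (e m) a"
    and A: "vector_space_on A" "\<one>\<^bsub>A\<^esub> \<in> carrier A"
      "\<And>a b. a \<in> carrier A \<Longrightarrow> b \<in> carrier A \<Longrightarrow> a \<otimes>\<^bsub>A\<^esub> b \<in> carrier A"
  shows "right_module A N"
proof -
  have V: "vector_space_on M" and l: "\<And>a. a \<in> carrier A \<Longrightarrow> linear_on M M (\<lambda>m. act M m a)"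
    and r: "\<And>m. m \<in> carrier M \<Longrightarrow> linear_on A M (act M m)"
    and assoc: "\<And>m a b. m \<in> carrier M \<Longrightarrow> a \<in> carrier A \<Longrightarrow> b \<in> carrier A \<Longrightarrow>
      act M m (a \<otimes>\<^bsub>A\<^esub> b) = act M (act M m a) b"
    and one: "\<And>m. m \<in> carrier M \<Longrightarrow> act M m \<one>\<^bsub>A\<^esub> = m"
    using M by (auto simp: right_module_def)
  note closed = A(2,3) vector_space_onD(2) [OF A(1)] abelian_groupE(1) [OF vector_space_onD(1) [OF A(1)]]
  interpret M: abelian_group M by (rule vector_space_onD(1) [OF V])
  note add = linear_onD(2) [OF e, symmetric] and smult = linear_onD(3) [OF e, symmetric]
  have all: "(\<forall>n\<in>carrier N. P n) \<longleftrightarrow> (\<forall>m\<in>carrier M. P (e m))" for P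
    by (simp flip: onto)
  have eN: "\<And>m. m \<in> carrier M \<Longrightarrow> e m \<in> carrier N" using onto by blast
  have N: "n \<in> carrier N \<longleftrightarrow> (\<exists>m\<in>carrier M. n = e m)" for n using onto by blast
  have actM: "\<And>m a. m \<in> carrier M \<Longrightarrow> a \<in> carrier A \<Longrightarrow> act M m a \<in> carrier M"
    using l linear_onD(1) by fastforce
  have actN: "act N n a \<in> carrier N" if n: "n \<in> carrier N" and a: "a \<in> carrier A" for n a
  proof -
    obtain m where m: "m \<in> carrier M" "n = e m" using n N by blast
    then show ?thesis using act [OF m(1) a] eN [OF actM [OF m(1) a]] by simp
  qed
  have "abelian_group N"
  proof (rule abelian_groupI)
    fix n assume "n \<in> carrier N"
    then obtain m where m: "m \<in> carrier M" "n = e m" using N by blast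
    then have "e (\<ominus>\<^bsub>M\<^esub> m) \<oplus>\<^bsub>N\<^esub> n = \<zero>\<^bsub>N\<^esub>"
      by (simp add: add M.l_neg zero)
    then show "\<exists>y\<in>carrier N. y \<oplus>\<^bsub>N\<^esub> n = \<zero>\<^bsub>N\<^esub>" using m eN by blast
  qed (use zero in \<open>auto simp: N add M.a_ac simp flip: zero\<close>)
  then have "vector_space_on N"
    by (rule vector_space_onI)
      (auto simp: N add smult vector_space_onD [OF V])
  then show ?thesis
    unfolding right_module_def linear_on_def Pi_def all mem_Collect_eq
    using linear_onD [OF l] linear_onD [OF r]
    by (auto simp: add smult vector_space_onD(2) [OF V] eN actM actN assoc one closed simp flip: act)
qed

context
  fixes \<chi> \<eta> :: "'a \<Rightarrow> 'k::field" and V W :: "('k, 'a, 'x) umodule"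
  defines "V \<equiv> line_module \<chi>" and "W \<equiv> line_module \<eta>"
begin

interpretation vector_space_pair V W
  unfolding V_def W_def by (intro vector_space_pair.intro vector_space_on_line_module)

lemma bilinear_on_line_modules:
  "bilinear_on V W field_algebra (\<lambda>m n. the_scalar m * the_scalar n)"
  by (auto simp: bilinear_on_def V_def W_def algebra_simps intro!: linear_onI)

text \<open>
  Moving all scalars to the left entry and adding up gives a normal form \<open>r \<otimes> 1\<close> for the elements of
  the tensor product of two lines, and \<open>bilinear_on_line_modules\<close> recovers \<open>r\<close> from any representative.
\<close>

lemma tensor_eq_line_modules:
  assumes "set xs \<subseteq> carrier V \<times> carrier W"
  shows "tensor_eq V W xs [(Scalar (\<Sum>(m, n)\<leftarrow>xs. the_scalar m * the_scalar n), Scalar 1)]"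
  using assms
proof (induction xs)
  case Nil
  have "Scalar 1 \<in> carrier W" by (simp add: W_def)
  then have "tensor_eq V W [(\<zero>\<^bsub>V\<^esub>, Scalar 1)] []" by (rule tensor_eq.zero)
  then show ?case by (simp add: V_def tensor_eq.sym)
next
  case (Cons p xs)
  obtain s t where p: "p = (Scalar s, Scalar t)"
    using Cons.prems by (cases p) (auto simp: V_def W_def)
  define r where "r = (\<Sum>(m, n)\<leftarrow>xs. the_scalar m * the_scalar n)"
  have S: "Scalar q \<in> carrier V" "Scalar q \<in> carrier W" for q by (simp_all add: V_def W_def)
  have "tensor_eq V W [(t \<odot>\<^bsub>V\<^esub> Scalar s, Scalar 1)] [(Scalar s, t \<odot>\<^bsub>W\<^esub> Scalar 1)]"
    using S by (intro tensor_eq.smult)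
  then have "tensor_eq V W [p] [(Scalar (s * t), Scalar 1)]"
    using p by (simp add: V_def W_def mult.commute tensor_eq.sym)
  moreover have "tensor_eq V W xs [(Scalar r, Scalar 1)]"
    using Cons by (simp add: r_def)
  ultimately have "tensor_eq V W (p # xs) [(Scalar (s * t), Scalar 1), (Scalar r, Scalar 1)]"
    using tensor_eq.append by fastforce
  moreover have "tensor_eq V W [(Scalar (s * t) \<oplus>\<^bsub>V\<^esub> Scalar r, Scalar 1)]
      [(Scalar (s * t), Scalar 1), (Scalar r, Scalar 1)]"
    using S by (intro tensor_eq.add_left)
  ultimately have "tensor_eq V W (p # xs) [(Scalar (s * t) \<oplus>\<^bsub>V\<^esub> Scalar r, Scalar 1)]"
    by (blast intro: tensor_eq.sym tensor_eq.trans)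
  then show ?case using p by (simp add: V_def r_def)
qed

lemma tsum_line_modules:
  assumes "set xs \<subseteq> carrier V \<times> carrier W"
  shows "tsum V W xs = tsum V W [(Scalar (\<Sum>(m, n)\<leftarrow>xs. the_scalar m * the_scalar n), Scalar 1)]"
  using assms by (intro tsum_cong tensor_eq_line_modules)

lemma sum_tsum_line_modules:
  assumes "set xs \<subseteq> carrier V \<times> carrier W"
  shows "(\<Sum>(m, n)\<leftarrow>tsum V W xs. the_scalar m * the_scalar n) = (\<Sum>(m, n)\<leftarrow>xs. the_scalar m * the_scalar n)"
  using tensor_lift_tsum [OF vector_space_on_field_algebra bilinear_on_line_modules assms]
  by (simp add: tensor_lift_field_algebra)

definition line_to_tensor :: "('k, 'x) universe \<Rightarrow> ('k, 'x) universe" where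
  "line_to_tensor u = utsum V W [(u, Scalar 1)]"

lemma sum_line_to_tensor:
  "(\<Sum>(m, n)\<leftarrow>the_tensors (line_to_tensor (Scalar s)). the_scalar m * the_scalar n) = s"
  using sum_tsum_line_modules [of "[(Scalar s, Scalar 1)]"]
  by (simp add: line_to_tensor_def utsum_def V_def W_def)

lemma linear_iso_on_line_to_tensor:
  "linear_iso_on (line_module \<zeta>) (tensor_module H V W) line_to_tensor"
proof -
  have "linear_on V (tensor V W) (\<lambda>u. tsum V W [(u, Scalar 1)])"
    using bilinear_on_tsum by (auto simp: bilinear_on_def W_def)
  then have "linear_on (line_module \<zeta>) (tensor_module H V W) line_to_tensor"
    by (simp add: linear_on_def tensor_module_def line_to_tensor_def utsum_def V_def Pi_iff)
  moreover have "inj_on line_to_tensor (range Scalar)"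
    by (rule inj_onI) (metis imageE sum_line_to_tensor)
  moreover have "line_to_tensor ` range Scalar = carrier (tensor_module H V W)"
  proof
    show "line_to_tensor ` range Scalar \<subseteq> carrier (tensor_module H V W)"
      using calculation(1) by (auto simp: linear_on_def)
    show "carrier (tensor_module H V W) \<subseteq> line_to_tensor ` range Scalar"
      using tsum_line_modules
      by (auto simp: tensor_module_def tensor_def line_to_tensor_def utsum_def)
  qed
  ultimately show ?thesis by (simp add: linear_iso_on_def bij_betw_def)
qed

text \<open>
  Acting by \<open>a\<close> through the comultiplication multiplies the normal form by \<open>\<Sum> \<chi>(a\<^sub>1) \<eta>(a\<^sub>2)\<close>: the
  tensor product of two characters is their convolution product.
\<close>

lemma line_to_tensor_act:
  assumes "u \<in> range Scalar"
    and \<zeta>: "\<zeta> a = tensor_lift field_algebra (\<lambda>x y. \<chi> x * \<eta> y) (comult H a)"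
  shows "line_to_tensor (act (line_module \<zeta>) u a) = act (tensor_module H V W) (line_to_tensor u) a"
proof -
  obtain s where u: "u = Scalar s" using assms(1) by blast
  let ?l = "[(act V m x, act W n y). (m, n) \<leftarrow> the_tensors (line_to_tensor u), (x, y) \<leftarrow> comult H a]"
  have inner: "(\<Sum>(m', n')\<leftarrow>map (\<lambda>(x, y). (act V m x, act W n y)) ys. the_scalar m' * the_scalar n') =
      the_scalar m * the_scalar n * (\<Sum>(x, y)\<leftarrow>ys. \<chi> x * \<eta> y)" for m n ys
    by (induction ys) (auto simp: V_def W_def algebra_simps)
  have "(\<Sum>(m, n)\<leftarrow>[(act V m x, act W n y). (m, n) \<leftarrow> xs, (x, y) \<leftarrow> ys]. the_scalar m * the_scalar n) =
      (\<Sum>(m, n)\<leftarrow>xs. the_scalar m * the_scalar n) * (\<Sum>(x, y)\<leftarrow>ys. \<chi> x * \<eta> y)" for xs ys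
    by (induction xs) (auto simp: inner algebra_simps simp del: map_map)
  then have "(\<Sum>(m, n)\<leftarrow>?l. the_scalar m * the_scalar n) = s * \<zeta> a"
    by (simp only: u sum_line_to_tensor \<zeta> tensor_lift_field_algebra)
  moreover have "set ?l \<subseteq> carrier V \<times> carrier W"
    by (auto simp: V_def W_def)
  ultimately have "tsum V W ?l = tsum V W [(Scalar (s * \<zeta> a), Scalar 1)]"
    using tsum_line_modules by metis
  then show ?thesis
    by (simp add: tensor_module_def utsum_def line_to_tensor_def u)
qed

end


section \<open>Categories of modules\<close>

lemma mod_category_simps:
  "Ob (mod_category U G H \<phi> c) = {M. right_module H M}"
  "Hom (mod_category U G H \<phi> c) = module_homs H"
  "Id (mod_category U G H \<phi> c) M = mor M (\<lambda>m. m) M"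
  "Comp (mod_category U G H \<phi> c) (N', f, P) (M, e, N) = mor M (f \<circ> e) P"
  "HomScale (mod_category U G H \<phi> c) s (M, f, N) = mor M (\<lambda>m. s \<odot>\<^bsub>N\<^esub> f m) N"
  "TOb (mod_category U G H \<phi> c) = tensor_module H"
  "Unit (mod_category U G H \<phi> c) = unit_module H"
  "ActOb (mod_category U G H \<phi> c) g = twist (\<phi> (inv\<^bsub>G\<^esub> g))"
  "ActMor (mod_category U G H \<phi> c) g (M, f, N) = mor (twist (\<phi> (inv\<^bsub>G\<^esub> g)) M) f (twist (\<phi> (inv\<^bsub>G\<^esub> g)) N)"
  "Compositor (mod_category U G H \<phi> c) g h M = mor (twist (\<phi> (inv\<^bsub>G\<^esub> g)) (twist (\<phi> (inv\<^bsub>G\<^esub> h)) M))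
     (\<lambda>m. act M m (c (inv\<^bsub>G\<^esub> h) (inv\<^bsub>G\<^esub> g))) (twist (\<phi> (inv\<^bsub>G\<^esub> (g \<otimes>\<^bsub>G\<^esub> h))) M)"
  by (simp_all add: mod_category_def)

lemma twist_simps [simp]:
  "carrier (twist f M) = carrier M" "linear_on N (twist f M) = linear_on N M"
  "linear_on (twist f M) N = linear_on M N"
  by (simp_all add: twist_def linear_on_def fun_eq_iff)

text \<open>
  The inverse of a bijective module homomorphism is again a module homomorphism. The converse keeps only
  the linear bijection, because modules over \<open>B\<close> will be compared as vector spaces.
\<close>

lemma is_iso_mod_categoryI:
  assumes M: "right_module H M" and f: "linear_iso_on M N f"
    and act: "\<And>m a. m \<in> carrier M \<Longrightarrow> a \<in> carrier H \<Longrightarrow> f (act M m a) = act N (f m) a"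
  shows "is_iso (mod_category U G H \<phi> c) M N (mor M f N)"
proof -
  define h where "h = inv_into (carrier M) f"
  have V: "vector_space_on M" using M by (simp add: right_module_def)
  have h: "linear_iso_on N M h"
    unfolding h_def by (rule linear_iso_on_inv_into [OF V f])
  have b: "bij_betw f (carrier M) (carrier N)" using f by (simp add: linear_iso_on_def)
  have fN: "f m \<in> carrier N" and hf: "h (f m) = m" if "m \<in> carrier M" for m
    using that b by (auto simp: h_def bij_betw_apply bij_betw_inv_into_left)
  have hM: "h n \<in> carrier M" and fh: "f (h n) = n" if "n \<in> carrier N" for n
    using that b h by (auto simp: h_def linear_iso_on_def bij_betw_apply bij_betw_inv_into_right)
  have actM: "act M m a \<in> carrier M" if "m \<in> carrier M" "a \<in> carrier H" for m a
    using M that by (auto simp: right_module_def linear_on_def)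
  have "h (act N n a) = act M (h n) a" if "n \<in> carrier N" "a \<in> carrier H" for n a
    using act [OF hM [OF that(1)] that(2)] hf [OF actM [OF hM [OF that(1)] that(2)]] fh [OF that(1)]
    by simp
  then have "mor N h M \<in> module_homs H N M"
    using h by (auto simp: module_homs_def linear_iso_on_def)
  moreover have "mor M f N \<in> module_homs H M N"
    using f act by (auto simp: module_homs_def linear_iso_on_def)
  ultimately show ?thesis
    unfolding is_iso_def
    by (auto simp: mod_category_simps mor_def fun_eq_iff fN hf hM fh restrict_def
        intro!: bexI [of _ "mor N h M"])
qed

lemma is_iso_mod_categoryD:
  assumes "is_iso (mod_category U G H \<phi> c) M N f"
  obtains h where "f = mor M h N" "linear_iso_on M N h"
proof -
  obtain h e where h: "f = mor M h N" "linear_on M N h" and e: "linear_on N M e"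
    and "Comp (mod_category U G H \<phi> c) (mor N e M) f = mor M (\<lambda>m. m) M"
    and "Comp (mod_category U G H \<phi> c) f (mor N e M) = mor N (\<lambda>m. m) N"
    using assms by (auto simp: is_iso_def mod_category_simps module_homs_def)
  then have c: "restrict (restrict e (carrier N) \<circ> restrict h (carrier M)) (carrier M) = restrict (\<lambda>m. m) (carrier M)"
    "restrict (restrict h (carrier M) \<circ> restrict e (carrier N)) (carrier N) = restrict (\<lambda>m. m) (carrier N)"
    by (simp_all add: mor_def mod_category_simps)
  have "e (h m) = m" if "m \<in> carrier M" for m
    using fun_cong [OF c(1), of m] that linear_onD(1) [OF h(2) that] by simp
  moreover have "h (e n) = n" if "n \<in> carrier N" for n
    using fun_cong [OF c(2), of n] that linear_onD(1) [OF e that] by simp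
  ultimately have "bij_betw h (carrier M) (carrier N)"
    using h(2) e by (intro bij_betwI [of _ _ _ e]) (auto simp: linear_on_def)
  then show thesis using that h by (simp add: linear_iso_on_def)
qed

lemma functor_is_iso:
  assumes "is_functor C D F F'" "X \<in> Ob C" "Y \<in> Ob C" "is_iso C X Y f"
  shows "is_iso D (F X) (F Y) (F' f)"
proof -
  obtain e where "f \<in> Hom C X Y" "e \<in> Hom C Y X" "Comp C e f = Id C X" "Comp C f e = Id C Y"
    using assms(4) by (auto simp: is_iso_def)
  with assms(1-3) show ?thesis
    unfolding is_iso_def is_functor_def by metis
qed

lemma linear_iso_on_Tensors: "linear_iso_on (tensor M N) (tensor_module H M N) Tensors"
  by (auto simp: linear_iso_on_def linear_on_def tensor_module_def bij_betw_def inj_on_def)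

text \<open>
  The hypothesis on \<open>\<zeta>\<close> makes it the convolution product of \<open>\<chi>\<close> and \<open>\<eta>\<close>. For the square of the sign
  character this is the counit, and the isomorphism then starts at the tensor unit.
\<close>

lemma right_module_tensor_line_modules:
  fixes H :: "('k::field, 'a) hopf"
  assumes "vector_space_on H" "\<one>\<^bsub>H\<^esub> \<in> carrier H"
    "\<And>a b. a \<in> carrier H \<Longrightarrow> b \<in> carrier H \<Longrightarrow> a \<otimes>\<^bsub>H\<^esub> b \<in> carrier H"
    and hom: "algebra_hom H field_algebra \<zeta>"
    and \<zeta>: "\<And>a. a \<in> carrier H \<Longrightarrow> \<zeta> a = tensor_lift field_algebra (\<lambda>x y. \<chi> x * \<eta> y) (comult H a)"
  defines "T \<equiv> tensor_module H (line_module \<chi>) (line_module \<eta>) :: ('k, 'a, 'x) umodule"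
  shows "right_module H T"
    and "is_iso (mod_category U G H \<phi> c) (line_module \<zeta>) T (mor (line_module \<zeta>) (line_to_tensor \<chi> \<eta>) T)"
proof -
  have iso: "linear_iso_on (line_module \<zeta>) T (line_to_tensor \<chi> \<eta>)"
    unfolding T_def by (rule linear_iso_on_line_to_tensor)
  note lin = iso [unfolded linear_iso_on_def, THEN conjunct1]
    and bij = iso [unfolded linear_iso_on_def, THEN conjunct2]
  have act: "line_to_tensor \<chi> \<eta> (act (line_module \<zeta>) m a) = act T (line_to_tensor \<chi> \<eta> m) a"
    if "m \<in> carrier (line_module \<zeta>)" "a \<in> carrier H" for m a
    using that unfolding T_def by (intro line_to_tensor_act \<zeta>) auto
  have zero: "line_to_tensor \<chi> \<eta> \<zero>\<^bsub>line_module \<zeta>\<^esub> = \<zero>\<^bsub>T\<^esub>"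
    using tsum_line_modules [of "[]" \<chi> \<eta>, symmetric]
    by (simp add: T_def line_to_tensor_def utsum_def tensor_module_def tensor_def)
  show "right_module H T"
    by (rule right_module_image [OF right_module_line_module [OF hom] lin _ zero act])
      (use assms bij in \<open>auto simp: bij_betw_def\<close>)
  show "is_iso (mod_category U G H \<phi> c) (line_module \<zeta>) T (mor (line_module \<zeta>) (line_to_tensor \<chi> \<eta>) T)"
    by (rule is_iso_mod_categoryI [OF right_module_line_module [OF hom] iso act])
qed

section \<open>Group algebras and their characters\<close>

lemma group_hopf_algebra_simps:
  "carrier (group_hopf_algebra G) = {f. finite {x. f x \<noteq> 0} \<and> {x. f x \<noteq> 0} \<subseteq> carrier G}"
  "f \<otimes>\<^bsub>group_hopf_algebra G\<^esub> h = (\<lambda>x. \<Sum>(y, z) | f y \<noteq> 0 \<and> h z \<noteq> 0 \<and> y \<otimes>\<^bsub>G\<^esub> z = x. f y * h z)"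
  "\<one>\<^bsub>group_hopf_algebra G\<^esub> = group_elem \<one>\<^bsub>G\<^esub>"
  "\<zero>\<^bsub>group_hopf_algebra G\<^esub> = (\<lambda>x. 0)"
  "f \<oplus>\<^bsub>group_hopf_algebra G\<^esub> h = (\<lambda>x. f x + h x)"
  "s \<odot>\<^bsub>group_hopf_algebra G\<^esub> f = (\<lambda>x. s * f x)"
  "counit (group_hopf_algebra G) f = (\<Sum>x | f x \<noteq> 0. f x)"
  by (simp_all add: group_hopf_algebra_def group_algebra_def module.defs group_elem_def)

lemma group_algebra_simps:
  "carrier (group_algebra G) = carrier (group_hopf_algebra G)"
  "\<zero>\<^bsub>group_algebra G\<^esub> = \<zero>\<^bsub>group_hopf_algebra G\<^esub>"
  "f \<oplus>\<^bsub>group_algebra G\<^esub> h = f \<oplus>\<^bsub>group_hopf_algebra G\<^esub> h"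
  "s \<odot>\<^bsub>group_algebra G\<^esub> f = s \<odot>\<^bsub>group_hopf_algebra G\<^esub> f"
  by (simp_all add: group_hopf_algebra_def group_algebra_def module.defs)

lemma supp_group_elem: "{x. group_elem g x \<noteq> (0::'k::field)} = {g}"
  by (auto simp: group_elem_def)

lemma vector_space_on_group_algebra:
  fixes G :: "('g, 'r) monoid_scheme"
  shows "vector_space_on (group_algebra G :: ('k::field, 'g \<Rightarrow> 'k) module)"
proof (intro vector_space_onI abelian_groupI; unfold group_algebra_simps)
  fix f h :: "'g \<Rightarrow> 'k" assume fh: "f \<in> carrier (group_hopf_algebra G)" "h \<in> carrier (group_hopf_algebra G)"
  have "{x. f x + h x \<noteq> 0} \<subseteq> {x. f x \<noteq> 0} \<union> {x. h x \<noteq> 0}" by auto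
  with fh show "f \<oplus>\<^bsub>group_hopf_algebra G\<^esub> h \<in> carrier (group_hopf_algebra G)"
    by (auto simp: group_hopf_algebra_simps dest: finite_subset)
next
  fix f :: "'g \<Rightarrow> 'k" assume "f \<in> carrier (group_hopf_algebra G)"
  then show "\<exists>h\<in>carrier (group_hopf_algebra G). h \<oplus>\<^bsub>group_hopf_algebra G\<^esub> f = \<zero>\<^bsub>group_hopf_algebra G\<^esub>"
    by (intro bexI [of _ "\<lambda>x. - f x"]) (auto simp: group_hopf_algebra_simps)
next
  fix s and f :: "'g \<Rightarrow> 'k" assume f: "f \<in> carrier (group_hopf_algebra G)"
  have "{x. s * f x \<noteq> 0} \<subseteq> {x. f x \<noteq> 0}" by auto
  with f show "s \<odot>\<^bsub>group_hopf_algebra G\<^esub> f \<in> carrier (group_hopf_algebra G)"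
    by (auto simp: group_hopf_algebra_simps dest: finite_subset)
qed (auto simp: group_hopf_algebra_simps algebra_simps)

lemma vector_space_on_group_hopf_algebra: "vector_space_on (group_hopf_algebra G)"
  using vector_space_on_group_algebra [of G] vector_space_onD [OF vector_space_on_group_algebra [of G]]
    abelian_groupE [OF vector_space_onD(1) [OF vector_space_on_group_algebra [of G]]]
  by (intro vector_space_onI abelian_groupI) (simp_all add: group_algebra_simps)

lemma supp_group_algebra_mult:
  assumes "f \<in> carrier (group_hopf_algebra G)" "h \<in> carrier (group_hopf_algebra G)"
  shows "{x. (f \<otimes>\<^bsub>group_hopf_algebra G\<^esub> h) x \<noteq> 0} \<subseteq> (\<lambda>(y, z). y \<otimes>\<^bsub>G\<^esub> z) ` ({x. f x \<noteq> 0} \<times> {x. h x \<noteq> 0})"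
proof
  fix x assume "x \<in> {x. (f \<otimes>\<^bsub>group_hopf_algebra G\<^esub> h) x \<noteq> 0}"
  then have "{(y, z). f y \<noteq> 0 \<and> h z \<noteq> 0 \<and> y \<otimes>\<^bsub>G\<^esub> z = x} \<noteq> {}"
    by (intro notI) (simp add: group_hopf_algebra_simps)
  then show "x \<in> (\<lambda>(y, z). y \<otimes>\<^bsub>G\<^esub> z) ` ({x. f x \<noteq> 0} \<times> {x. h x \<noteq> 0})" by force
qed

lemma group_algebra_mult_closed:
  assumes "group G" and f: "f \<in> carrier (group_hopf_algebra G)" and h: "h \<in> carrier (group_hopf_algebra G)"
  shows "f \<otimes>\<^bsub>group_hopf_algebra G\<^esub> h \<in> carrier (group_hopf_algebra G)"
proof -
  interpret group G by fact
  let ?S = "(\<lambda>(y, z). y \<otimes>\<^bsub>G\<^esub> z) ` ({x. f x \<noteq> 0} \<times> {x. h x \<noteq> 0})"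
  have "finite ?S" "?S \<subseteq> carrier G"
    using f h by (auto simp: group_hopf_algebra_simps(1))
  then show ?thesis
    using supp_group_algebra_mult [OF f h] unfolding group_hopf_algebra_simps(1) mem_Collect_eq
    by (meson finite_subset subset_trans)
qed

definition character_extension :: "('g \<Rightarrow> 'k) \<Rightarrow> ('g \<Rightarrow> 'k) \<Rightarrow> 'k::field" where
  "character_extension \<chi> f = (\<Sum>x | f x \<noteq> 0. f x * \<chi> x)"

lemma character_extension_eq:
  assumes "finite S" "{x. f x \<noteq> 0} \<subseteq> S"
  shows "character_extension \<chi> f = (\<Sum>x\<in>S. f x * \<chi> x)"
  unfolding character_extension_def using assms by (intro sum.mono_neutral_left) auto

lemma character_extension_group_elem: "character_extension \<chi> (group_elem g) = \<chi> g"
  by (simp add: character_extension_def supp_group_elem) (simp add: group_elem_def)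

lemma counit_group_hopf_algebra: "counit (group_hopf_algebra G) = character_extension (\<lambda>x. 1)"
  by (simp add: fun_eq_iff group_hopf_algebra_simps character_extension_def)

lemma linear_on_character_extension:
  fixes G :: "('g, 'r) monoid_scheme" and \<chi> :: "'g \<Rightarrow> 'k::field"
  shows "linear_on (group_hopf_algebra G) field_algebra (character_extension \<chi>)"
proof (rule linear_onI)
  fix f h :: "'g \<Rightarrow> 'k" assume fh: "f \<in> carrier (group_hopf_algebra G)" "h \<in> carrier (group_hopf_algebra G)"
  let ?S = "{x. f x \<noteq> 0} \<union> {x. h x \<noteq> 0}"
  have S: "finite ?S" using fh by (simp add: group_hopf_algebra_simps(1))
  have "character_extension \<chi> (\<lambda>x. f x + h x) = (\<Sum>x\<in>?S. (f x + h x) * \<chi> x)"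
    using S by (intro character_extension_eq) auto
  also have "\<dots> = character_extension \<chi> f + character_extension \<chi> h"
    using S by (simp add: character_extension_eq [of ?S] algebra_simps sum.distrib)
  finally show "character_extension \<chi> (f \<oplus>\<^bsub>group_hopf_algebra G\<^esub> h) =
      character_extension \<chi> f \<oplus>\<^bsub>field_algebra\<^esub> character_extension \<chi> h"
    by (simp add: group_hopf_algebra_simps)
next
  fix s and f :: "'g \<Rightarrow> 'k" assume "f \<in> carrier (group_hopf_algebra G)"
  then have S: "finite {x. f x \<noteq> 0}" by (simp add: group_hopf_algebra_simps(1))
  have "character_extension \<chi> (\<lambda>x. s * f x) = (\<Sum>x | f x \<noteq> 0. s * f x * \<chi> x)"
    using S by (intro character_extension_eq) auto
  then show "character_extension \<chi> (s \<odot>\<^bsub>group_hopf_algebra G\<^esub> f) =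
      s \<odot>\<^bsub>field_algebra\<^esub> character_extension \<chi> f"
    by (simp add: group_hopf_algebra_simps character_extension_def sum_distrib_left mult.assoc)
qed simp

lemma algebra_hom_character_extension:
  assumes "group G" and \<chi>_one: "\<chi> \<one>\<^bsub>G\<^esub> = 1"
    and \<chi>_mult: "\<And>x y. x \<in> carrier G \<Longrightarrow> y \<in> carrier G \<Longrightarrow> \<chi> (x \<otimes>\<^bsub>G\<^esub> y) = \<chi> x * \<chi> y"
  shows "algebra_hom (group_hopf_algebra G) field_algebra (character_extension \<chi>)"
proof -
  have "character_extension \<chi> (f \<otimes>\<^bsub>group_hopf_algebra G\<^esub> h) = character_extension \<chi> f * character_extension \<chi> h"
    if f: "f \<in> carrier (group_hopf_algebra G)" and h: "h \<in> carrier (group_hopf_algebra G)" for f h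
  proof -
    let ?P = "{x. f x \<noteq> 0} \<times> {x. h x \<noteq> 0}"
    let ?m = "\<lambda>(y, z). y \<otimes>\<^bsub>G\<^esub> z"
    have P: "finite ?P" "?P \<subseteq> carrier G \<times> carrier G"
      using f h by (auto simp: group_hopf_algebra_simps(1))
    have P_eq: "{(y, z). f y \<noteq> 0 \<and> h z \<noteq> 0 \<and> y \<otimes>\<^bsub>G\<^esub> z = x} = {p \<in> ?P. ?m p = x}" for x by auto
    \<comment> \<open>The double sum over the product of the supports, grouped by the value of the product \<open>y z\<close>.\<close>
    have "character_extension \<chi> (f \<otimes>\<^bsub>group_hopf_algebra G\<^esub> h) =
        (\<Sum>x\<in>?m ` ?P. (f \<otimes>\<^bsub>group_hopf_algebra G\<^esub> h) x * \<chi> x)"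
      using P supp_group_algebra_mult [OF f h] by (intro character_extension_eq) auto
    also have "\<dots> = (\<Sum>x\<in>?m ` ?P. \<Sum>p\<in>{p \<in> ?P. ?m p = x}. f (fst p) * h (snd p) * \<chi> (?m p))"
    proof (rule sum.cong)
      fix x assume "x \<in> ?m ` ?P"
      have "(f \<otimes>\<^bsub>group_hopf_algebra G\<^esub> h) x = (\<Sum>p\<in>{p \<in> ?P. ?m p = x}. f (fst p) * h (snd p))"
        unfolding group_hopf_algebra_simps(2) P_eq by (simp add: split_def)
      then show "(f \<otimes>\<^bsub>group_hopf_algebra G\<^esub> h) x * \<chi> x =
          (\<Sum>p\<in>{p \<in> ?P. ?m p = x}. f (fst p) * h (snd p) * \<chi> (?m p))"
        by (simp add: sum_distrib_right)
    qed (rule HOL.refl)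
    also have "\<dots> = (\<Sum>p\<in>?P. f (fst p) * h (snd p) * \<chi> (?m p))"
      using P by (intro sum.group) auto
    also have "\<dots> = (\<Sum>p\<in>?P. (f (fst p) * \<chi> (fst p)) * (h (snd p) * \<chi> (snd p)))"
      using P by (intro sum.cong HOL.refl) (auto simp: \<chi>_mult)
    also have "\<dots> = character_extension \<chi> f * character_extension \<chi> h"
      by (simp add: character_extension_def sum_product sum.cartesian_product split_def)
    finally show ?thesis .
  qed
  then show ?thesis
    using linear_on_character_extension [of G \<chi>] \<chi>_one
    by (auto simp: algebra_hom_def ring_hom_def linear_on_def group_hopf_algebra_simps(3)
        character_extension_group_elem)
qed

text \<open>Group elements are group-like, so convolution of characters is their pointwise product.\<close>

lemma character_extension_comult:
  fixes G :: "('g, 'r) monoid_scheme" and \<chi> \<eta> :: "'g \<Rightarrow> 'k::field"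
  assumes f: "f \<in> carrier (group_hopf_algebra G)"
  shows "tensor_lift field_algebra (\<lambda>x y. character_extension \<chi> x * character_extension \<eta> y)
      (comult (group_hopf_algebra G) f) = character_extension (\<lambda>x. \<chi> x * \<eta> x) f"
proof -
  let ?A = "group_algebra G :: ('k, 'g \<Rightarrow> 'k) module" and ?\<beta> = "\<lambda>x y. character_extension \<chi> x * character_extension \<eta> y"
  let ?l = "tensor_lift field_algebra ?\<beta>"
  interpret vector_space_pair ?A ?A
    by (intro vector_space_pair.intro vector_space_on_group_algebra)
  have lin: "linear_on ?A field_algebra (character_extension \<chi>)" for \<chi> :: "'g \<Rightarrow> 'k"
    using linear_on_character_extension [of G \<chi>]
    by (simp add: linear_on_def group_algebra_simps)
  have bil: "bilinear_on ?A ?A field_algebra ?\<beta>"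
    using linear_onD [OF lin [of \<chi>]] linear_onD [OF lin [of \<eta>]]
    by (auto simp: bilinear_on_def algebra_simps intro!: linear_onI)
  note F = vector_space_on_field_algebra
  have supp: "{x. f x \<noteq> 0} \<subseteq> carrier G" "finite {x. f x \<noteq> 0}"
    using f by (auto simp: group_hopf_algebra_simps(1))
  define d where "d x = tsum ?A ?A [(group_elem x, group_elem x)]" for x
  have g: "group_elem x \<in> carrier ?A" if "x \<in> carrier G" for x
    using that by (simp add: group_algebra_simps group_hopf_algebra_simps supp_group_elem)
  have d: "d x \<in> carrier (tensor ?A ?A)" "f x \<odot>\<^bsub>tensor ?A ?A\<^esub> d x \<in> carrier (tensor ?A ?A)"
    if "x \<in> carrier G" for x
    using that g vector_space_onD(2) [OF vector_space_on_group_algebra g]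
    by (auto simp: d_def tensor_smult intro!: tsum_in_carrier)
  have l: "linear_on (tensor ?A ?A) field_algebra ?l"
    by (rule linear_on_tensor_lift [OF F bil])
  have l0: "?l \<zero>\<^bsub>tensor ?A ?A\<^esub> = 0"
    using tensor_lift_tsum [OF F bil, of "[]"] by (simp add: tensor_def)
  have "comult (group_hopf_algebra G) f = (\<Oplus>\<^bsub>tensor ?A ?A\<^esub>x\<in>{x. f x \<noteq> 0}. f x \<odot>\<^bsub>tensor ?A ?A\<^esub> d x)"
    by (simp add: group_hopf_algebra_def module.defs d_def)
  then have "?l (comult (group_hopf_algebra G) f) = (\<Sum>x | f x \<noteq> 0. ?l (f x \<odot>\<^bsub>tensor ?A ?A\<^esub> d x))"
    using linear_functional_finsum [OF abelian_monoid_tensor l l0 supp(2)] supp(1) d(2)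
    by (simp add: Pi_iff subset_iff)
  also have "\<dots> = (\<Sum>x | f x \<noteq> 0. f x * (\<chi> x * \<eta> x))"
  proof (intro sum.cong HOL.refl)
    fix x assume "x \<in> {x. f x \<noteq> 0}"
    then have x: "x \<in> carrier G" using supp by blast
    have "?l (d x) = \<chi> x * \<eta> x"
      using tensor_lift_tsum [OF F bil, of "[(group_elem x, group_elem x)]"] g [OF x]
      by (simp add: d_def character_extension_group_elem)
    then show "?l (f x \<odot>\<^bsub>tensor ?A ?A\<^esub> d x) = f x * (\<chi> x * \<eta> x)"
      using linear_onD(3) [OF l d(1) [OF x]] by simp
  qed
  finally show ?thesis by (simp add: character_extension_def)
qed


section \<open>The obstruction\<close>

definition sign :: "int \<Rightarrow> complex" where
  "sign x = (if even x then 1 else - 1)"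

abbreviation sign_module :: "(complex, int \<Rightarrow> complex, 'x) umodule" where
  "sign_module \<equiv> line_module (character_extension sign)"

lemma group_Klein4: "group Klein4"
  by (intro DirProd_group group_integer_mod_group)

lemma algebra_hom_sign: "algebra_hom A\<^sub>0 field_algebra (character_extension sign)"
  unfolding A\<^sub>0_def
  by (rule algebra_hom_character_extension) (auto simp: sign_def even_mod_2_iff)

lemma algebra_hom_counit_A0: "algebra_hom A\<^sub>0 field_algebra (counit A\<^sub>0)"
  unfolding A\<^sub>0_def counit_group_hopf_algebra
  by (rule algebra_hom_character_extension) auto

lemma sign_square_comult:
  assumes "a \<in> carrier A\<^sub>0"
  shows "counit A\<^sub>0 a =
    tensor_lift field_algebra (\<lambda>x y. character_extension sign x * character_extension sign y) (comult A\<^sub>0 a)"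
proof -
  have "(\<lambda>x. sign x * sign x) = (\<lambda>x. 1)" by (auto simp: sign_def)
  then show ?thesis
    using assms character_extension_comult [of a Z2 sign sign]
    by (simp add: A\<^sub>0_def counit_group_hopf_algebra)
qed

text \<open>
  The twist of a module over \<open>A\<^sub>0\<close> is the module itself, not only an isomorphic copy; therefore each
  \<open>\<psi>\<^sub>g(\<sigma>)\<close> starts at \<open>F \<sigma>\<close>.
\<close>

lemma twist_\<phi>\<^sub>0: "twist (\<phi>\<^sub>0 g) M = M"
  by (simp add: twist_def \<phi>\<^sub>0_def)

lemma Klein4_simps:
  "t1 \<in> carrier Klein4" "t2 \<in> carrier Klein4"
  "inv\<^bsub>Klein4\<^esub> t1 = t1" "inv\<^bsub>Klein4\<^esub> t2 = t2" "t2 \<otimes>\<^bsub>Klein4\<^esub> t1 = t1 \<otimes>\<^bsub>Klein4\<^esub> t2"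
  by (simp_all add: t1_def t2_def)

text \<open>The asymmetry that no strict action can reproduce.\<close>

lemma sign_compositors:
  "character_extension sign (c\<^sub>0 t2 t1) = - 1" "character_extension sign (c\<^sub>0 t1 t2) = 1"
  by (simp_all add: c\<^sub>0_def t12_def t1_def t2_def A\<^sub>0_def group_hopf_algebra_simps(3)
      character_extension_group_elem sign_def)

theorem theorem2:
  shows "\<nexists>(B :: (complex, 'b) hopf) \<phi> c.
    weak_hopf_action Klein4 B \<phi> c \<and> strict_compositors Klein4 B c \<and>
    equivalent_with_action Klein4
      (mod_category TYPE('x) Klein4 A\<^sub>0 \<phi>\<^sub>0 c\<^sub>0)
      (mod_category TYPE('x) Klein4 B \<phi> c)"
proof (intro notI, elim exE conjE)
  fix B :: "(complex, 'b) hopf" and \<phi> c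
  let ?C = "mod_category TYPE('x) Klein4 A\<^sub>0 \<phi>\<^sub>0 c\<^sub>0" and ?D = "mod_category TYPE('x) Klein4 B \<phi> c"
  let ?\<sigma> = "sign_module :: (complex, int \<Rightarrow> complex, 'x) umodule"
  assume strict: "strict_compositors Klein4 B c" and equiv: "equivalent_with_action Klein4 ?C ?D"
  interpret K: group Klein4 by (rule group_Klein4)
  obtain F F' J J\<^sub>0 \<psi> where lin: "linear_functor ?C ?D F F'"
    and mon: "strong_monoidal_functor ?C ?D F F' J J\<^sub>0"
    and \<psi>: "\<And>g. g \<in> carrier Klein4 \<Longrightarrow> natural_iso ?C ?D
        (F \<circ> ActOb ?C g) (F' \<circ> ActMor ?C g) (ActOb ?D g \<circ> F) (ActMor ?D g \<circ> F') (\<psi> g)"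
    and coh: "\<And>g h X. g \<in> carrier Klein4 \<Longrightarrow> h \<in> carrier Klein4 \<Longrightarrow> X \<in> Ob ?C \<Longrightarrow>
        Comp ?D (\<psi> (g \<otimes>\<^bsub>Klein4\<^esub> h) X) (F' (Compositor ?C g h X)) =
        Comp ?D (Compositor ?D g h (F X)) (Comp ?D (ActMor ?D g (\<psi> h X)) (\<psi> g (ActOb ?C h X)))"
    using equiv unfolding equivalent_with_action_def by blast
  have F_functor: "is_functor ?C ?D F F'" using lin by (simp add: linear_functor_def)
  let ?\<sigma>\<sigma> = "TOb ?C ?\<sigma> ?\<sigma>" and ?M = "F ?\<sigma>"

  have A: "vector_space_on A\<^sub>0" "\<one>\<^bsub>A\<^sub>0\<^esub> \<in> carrier A\<^sub>0"
      "\<And>a b. a \<in> carrier A\<^sub>0 \<Longrightarrow> b \<in> carrier A\<^sub>0 \<Longrightarrow> a \<otimes>\<^bsub>A\<^sub>0\<^esub> b \<in> carrier A\<^sub>0"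
    unfolding A\<^sub>0_def
    by (simp_all only: vector_space_on_group_hopf_algebra group_algebra_mult_closed group_integer_mod_group)
      (simp add: group_hopf_algebra_simps(1,3) supp_group_elem)
  have \<sigma>: "?\<sigma> \<in> Ob ?C"
    using right_module_line_module [OF algebra_hom_sign] by (simp add: mod_category_simps)
  have unit_Ob: "Unit ?C \<in> Ob ?C"
    using right_module_line_module [OF algebra_hom_counit_A0]
    by (simp add: mod_category_simps unit_module_eq_line_module)
  note square = right_module_tensor_line_modules [OF A algebra_hom_counit_A0 sign_square_comult]
  have \<sigma>\<sigma>: "?\<sigma>\<sigma> \<in> Ob ?C"
    using square(1) by (simp add: mod_category_simps)
  obtain e where e: "is_iso ?C (Unit ?C) ?\<sigma>\<sigma> e"
    using square(2) unfolding mod_category_simps(6,7) unit_module_eq_line_module by blast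

  have M: "right_module B ?M"
    using F_functor \<sigma> by (auto simp: is_functor_def mod_category_simps)
  then have V: "vector_space_on ?M" by (simp add: right_module_def)

  \<comment> \<open>\<open>F \<sigma> \<otimes> F \<sigma> \<cong> F (\<sigma> \<otimes> \<sigma>) \<cong> F 1 \<cong> 1\<close>, so that \<open>F \<sigma>\<close> is a line.\<close>
  have "is_iso ?D (tensor_module B ?M ?M) (F ?\<sigma>\<sigma>) (J ?\<sigma> ?\<sigma>)"
    using mon \<sigma> by (simp add: strong_monoidal_functor_def mod_category_simps(6))
  then obtain j where j: "linear_iso_on (tensor_module B ?M ?M) (F ?\<sigma>\<sigma>) j"
    by (rule is_iso_mod_categoryD)
  have "is_iso ?D (F (Unit ?C)) (F ?\<sigma>\<sigma>) (F' e)"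
    by (rule functor_is_iso [OF F_functor unit_Ob \<sigma>\<sigma> e])
  then obtain k where k: "linear_iso_on (F (Unit ?C)) (F ?\<sigma>\<sigma>) k"
    by (rule is_iso_mod_categoryD)
  have "is_iso ?D (unit_module B) (F (Unit ?C)) J\<^sub>0"
    using mon by (simp add: strong_monoidal_functor_def mod_category_simps(7))
  then obtain i where i: "linear_iso_on (unit_module B :: (complex, 'b, 'x) umodule) (F (Unit ?C)) i"
    by (rule is_iso_mod_categoryD)
  have "vector_space_on (F (Unit ?C))"
    using F_functor unit_Ob by (auto simp: is_functor_def mod_category_simps right_module_def)
  note k' = linear_iso_on_inv_into [OF this k]
  have i': "linear_iso_on (F (Unit ?C)) (unit_module B :: (complex, 'b, 'x) umodule) (inv_into (carrier (unit_module B)) i)"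
    using i unfolding unit_module_eq_line_module
    by (rule linear_iso_on_inv_into [OF vector_space_on_line_module])
  have scalar: "linear_iso_on (unit_module B :: (complex, 'b, 'x) umodule) field_algebra the_scalar"
    unfolding unit_module_eq_line_module by (rule linear_iso_on_the_scalar)
  have "\<exists>ev. linear_iso_on (tensor ?M ?M) field_algebra ev"
    by (rule exI, rule linear_iso_on_comp [OF _ scalar], rule linear_iso_on_comp [OF _ i'],
        rule linear_iso_on_comp [OF _ k'], rule linear_iso_on_comp [OF linear_iso_on_Tensors j])
  then obtain v where v: "v \<in> carrier ?M" "v \<noteq> \<zero>\<^bsub>?M\<^esub>"
    and span: "\<And>x. x \<in> carrier ?M \<Longrightarrow> \<exists>s. x = s \<odot>\<^bsub>?M\<^esub> v"
    using one_dimensional_if_tensor_square [OF V] by (elim exE) blast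

  \<comment> \<open>Twisting changes only the action, so each \<open>\<psi>\<^sub>g(\<sigma>)\<close> is an automorphism of the space \<open>F \<sigma>\<close>.\<close>
  have "\<exists>p. \<psi> g ?\<sigma> = mor ?M p (twist (\<phi> (inv\<^bsub>Klein4\<^esub> g)) ?M) \<and>
      linear_iso_on ?M (twist (\<phi> (inv\<^bsub>Klein4\<^esub> g)) ?M) p" if "g \<in> carrier Klein4" for g
  proof -
    have "is_iso ?D ?M (twist (\<phi> (inv\<^bsub>Klein4\<^esub> g)) ?M) (\<psi> g ?\<sigma>)"
      using \<psi> [OF that] \<sigma> by (auto simp: natural_iso_def mod_category_simps twist_\<phi>\<^sub>0)
    then show ?thesis by (rule is_iso_mod_categoryD) blast
  qed
  then obtain p where \<psi>_eq: "\<And>g. g \<in> carrier Klein4 \<Longrightarrow>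
      \<psi> g ?\<sigma> = mor ?M (p g) (twist (\<phi> (inv\<^bsub>Klein4\<^esub> g)) ?M)"
    and p_iso: "\<And>g. g \<in> carrier Klein4 \<Longrightarrow> linear_iso_on ?M (twist (\<phi> (inv\<^bsub>Klein4\<^esub> g)) ?M) (p g)"
    by metis
  have p: "linear_on ?M ?M (p g)" "bij_betw (p g) (carrier ?M) (carrier ?M)" if "g \<in> carrier Klein4" for g
    using p_iso [OF that] by (simp_all add: linear_iso_on_def)

  \<comment> \<open>The coherence condition at \<open>\<sigma>\<close>, where the compositors on the side of \<open>B\<close> are identities.\<close>
  have p_mult: "p (g \<otimes>\<^bsub>Klein4\<^esub> h)
      (character_extension sign (c\<^sub>0 (inv\<^bsub>Klein4\<^esub> h) (inv\<^bsub>Klein4\<^esub> g)) \<odot>\<^bsub>?M\<^esub> v) = p h (p g v)"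
    if g: "g \<in> carrier Klein4" and h: "h \<in> carrier Klein4" for g h
  proof -
    let ?s = "character_extension sign (c\<^sub>0 (inv\<^bsub>Klein4\<^esub> h) (inv\<^bsub>Klein4\<^esub> g))"
    \<comment> \<open>The functor is known on identities and on scalar multiples, so the compositor is rewritten as one.\<close>
    have "Compositor ?C g h ?\<sigma> = HomScale ?C ?s (Id ?C ?\<sigma>)"
      by (auto simp: mod_category_simps twist_\<phi>\<^sub>0 mor_def mult.commute)
    moreover have "Id ?C ?\<sigma> \<in> Hom ?C ?\<sigma> ?\<sigma>"
      by (auto simp: mod_category_simps module_homs_def linear_on_def)
    ultimately have "F' (Compositor ?C g h ?\<sigma>) = HomScale ?D ?s (Id ?D ?M)"
      using lin F_functor \<sigma> by (simp add: linear_functor_def is_functor_def)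
    then have F': "F' (Compositor ?C g h ?\<sigma>) = mor ?M (\<lambda>m. ?s \<odot>\<^bsub>?M\<^esub> m) ?M"
      by (auto simp: mod_category_simps mor_def)
    have one: "act ?M m (c (inv\<^bsub>Klein4\<^esub> h) (inv\<^bsub>Klein4\<^esub> g)) = m" if "m \<in> carrier ?M" for m
      using strict K.inv_closed [OF g] K.inv_closed [OF h] M that
      by (simp add: strict_compositors_def right_module_def del: carrier_DirProd inv_DirProd)
    have act: "ActOb ?C h ?\<sigma> = ?\<sigma>" by (simp add: mod_category_simps twist_\<phi>\<^sub>0)
    have pg: "p g v \<in> carrier ?M"
      by (rule linear_onD(1) [OF p(1) [OF g] v(1)])
    moreover have "p h (p g v) \<in> carrier ?M"
      by (rule linear_onD(1) [OF p(1) [OF h] pg])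
    moreover have "?s \<odot>\<^bsub>?M\<^esub> v \<in> carrier ?M" using v(1) V by (simp add: vector_space_onD)
    moreover have "Comp ?D (\<psi> (g \<otimes>\<^bsub>Klein4\<^esub> h) ?\<sigma>) (mor ?M (\<lambda>m. ?s \<odot>\<^bsub>?M\<^esub> m) ?M) =
        Comp ?D (Compositor ?D g h ?M) (Comp ?D (ActMor ?D g (\<psi> h ?\<sigma>)) (\<psi> g ?\<sigma>))"
      using coh [OF g h \<sigma>] by (simp only: F' act)
    then have "fst (snd (Comp ?D (\<psi> (g \<otimes>\<^bsub>Klein4\<^esub> h) ?\<sigma>) (mor ?M (\<lambda>m. ?s \<odot>\<^bsub>?M\<^esub> m) ?M))) v =
        fst (snd (Comp ?D (Compositor ?D g h ?M) (Comp ?D (ActMor ?D g (\<psi> h ?\<sigma>)) (\<psi> g ?\<sigma>)))) v"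
      by (rule arg_cong)
    ultimately show ?thesis
      using v(1) one unfolding \<psi>_eq [OF g] \<psi>_eq [OF h] \<psi>_eq [OF K.m_closed [OF g h]]
      by (simp add: mor_def mod_category_simps del: carrier_DirProd inv_DirProd)
  qed

  let ?t = "t1 \<otimes>\<^bsub>Klein4\<^esub> t2"
  have t: "?t \<in> carrier Klein4" by (intro K.m_closed Klein4_simps)
  have pt: "p ?t v \<in> carrier ?M" using p(1) [OF t] v(1) by (rule linear_onD(1))
  interpret M: abelian_group ?M by (rule vector_space_onD(1) [OF V])
  \<comment> \<open>Comparing the coherence conditions for \<open>(t\<^sub>1, t\<^sub>2)\<close> and \<open>(t\<^sub>2, t\<^sub>1)\<close>.\<close>
  have "(- 1) \<odot>\<^bsub>?M\<^esub> p ?t v = p ?t ((- 1) \<odot>\<^bsub>?M\<^esub> v)"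
    using linear_onD(3) [OF p(1) [OF t] v(1)] by simp
  also have "\<dots> = p t2 (p t1 v)"
    using p_mult [OF Klein4_simps(1,2)] unfolding Klein4_simps sign_compositors .
  also have "\<dots> = p t1 (p t2 v)"
    using endomorphisms_of_line_commute [OF V v(1) span] p(1) Klein4_simps(1,2) by blast
  also have "\<dots> = p ?t (1 \<odot>\<^bsub>?M\<^esub> v)"
    using p_mult [OF Klein4_simps(2,1)] unfolding Klein4_simps sign_compositors by simp
  also have "\<dots> = p ?t v"
    using v(1) by (simp add: vector_space_onD(6) [OF V])
  finally have neg: "(- 1) \<odot>\<^bsub>?M\<^esub> p ?t v = p ?t v" .
  have "2 \<odot>\<^bsub>?M\<^esub> p ?t v = (1 + 1) \<odot>\<^bsub>?M\<^esub> p ?t v" by simp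
  also have "\<dots> = 1 \<odot>\<^bsub>?M\<^esub> p ?t v \<oplus>\<^bsub>?M\<^esub> (- 1) \<odot>\<^bsub>?M\<^esub> p ?t v"
    using pt by (simp only: neg vector_space_onD(3,6) [OF V])
  also have "\<dots> = (1 + - 1) \<odot>\<^bsub>?M\<^esub> p ?t v"
    using pt by (simp only: vector_space_onD(3) [OF V])
  also have "\<dots> = \<zero>\<^bsub>?M\<^esub>"
    using pt by (simp add: vector_space_onD(7) [OF V])
  finally have "(1 / 2 * 2) \<odot>\<^bsub>?M\<^esub> p ?t v = \<zero>\<^bsub>?M\<^esub>"
    using pt by (simp only: vector_space_onD(5,8) [OF V])
  then have "p ?t v = p ?t \<zero>\<^bsub>?M\<^esub>"
    using pt linear_on_zero [OF V V p(1) [OF t]] by (simp add: vector_space_onD(6) [OF V])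
  then show False
    using v p(2) [OF t] by (auto simp: bij_betw_def inj_on_def)
qed

end
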